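(* Let $\mathcal{H}$ be a separable Hilbert space, let $P_1,\dots,P_K$ be non-atomic Borel probability distributions on $\mathcal{H}$, and let $\mathbf{X}_{ki}$ ($k=1,\dots,K$, $i=1,\dots,n_k$) be independent random elements with $\mathbf{X}_{ki}\sim P_k$, where $n=\sum_{k=1}^K n_k$. Assume that $n^{-1}n_k\to\lambda_k\in(0,1)$ for all $k$ as $n\to\infty$. Suppose that the null hypothesis $P_1=\cdots=P_K$ is not true, in such a way that $$\sum_{l=1}^K\lambda_l E[\mathbf{s}(\mathbf{X}_{k1}-\mathbf{X}_{l1})]\ne\mathbf{0}\quad\text{for at least one }k.$$ Then $\|E[\mathbf{U}_n]\|\to\infty$ as $n\to\infty$, and $SS_n\to\infty$ in probability as $n\to\infty$. As a consequence, for every $0<\alpha<1$, the power (rejection probability) of the level $\alpha$ test based on each of the asymptotic procedure, the bootstrap procedure and the permutation procedure (all described in the context) converges to $1$ as $n\to\infty$ and $M_b,M_p\to\infty$.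
   Context: $\mathcal{H}$ is a real separable Hilbert space; $K\ge2$ is fixed and the group sizes $n_k$ depend on $n$. Non-atomic means that every singleton has probability zero. Define $\mathbf{s}(\mathbf{x})=\mathbf{x}/\|\mathbf{x}\|$ for $\mathbf{x}\ne\mathbf{0}$, $\mathbf{s}(\mathbf{0})=\mathbf{0}$; $\mathbf{R}(\mathbf{x})=n^{-1}\sum_{k=1}^K\sum_{i=1}^{n_k}\mathbf{s}(\mathbf{x}-\mathbf{X}_{ki})$; $\bar{\mathbf{R}}_k=n_k^{-1}\sum_{i=1}^{n_k}\mathbf{R}(\mathbf{X}_{ki})$; $\mathbf{U}_n=(\sqrt{n_1}\bar{\mathbf{R}}_1,\dots,\sqrt{n_K}\bar{\mathbf{R}}_K)$ in the product Hilbert space $\mathcal{H}^K$; and the test statistic $SS_n=\|\mathbf{U}_n\|^2=\sum_{k=1}^K n_k\|\bar{\mathbf{R}}_k\|^2$. Each procedure produces a p-value, and the level $\alpha$ test rejects the null hypothesis when the p-value is at most $\alpha$. Asymptotic procedure: the p-value is the conditional probability, given the sample, that $\|\widehat{\mathbf{W}}\|^2\ge SS_n$, where given the sample $\widehat{\mathbf{W}}$ is a Gaussian random element of $\mathcal{H}^K$ with mean $\mathbf{0}$ and covariance operator $\widehat{\boldsymbol{\Sigma}}_n$. Here, with $(\mathbf{x}\otimes\mathbf{y})(\mathbf{w})=\langle\mathbf{w},\mathbf{x}\rangle\mathbf{y}$, $$\mathbf{C}_n(i,j,k)=\frac{1}{n_k-1}\sum_{l_k=1}^{n_k}\Big(\frac1{n_i}\sum_{l_i=1}^{n_i}\mathbf{s}(\mathbf{X}_{il_i}-\mathbf{X}_{kl_k})\Big)\otimes\Big(\frac1{n_j}\sum_{l_j=1}^{n_j}\mathbf{s}(\mathbf{X}_{jl_j}-\mathbf{X}_{kl_k})\Big)-\Big(\frac1{n_in_k}\sum_{l_i=1}^{n_i}\sum_{l_k=1}^{n_k}\mathbf{s}(\mathbf{X}_{il_i}-\mathbf{X}_{kl_k})\Big)\otimes\Big(\frac1{n_jn_k}\sum_{l_j=1}^{n_j}\sum_{l_k=1}^{n_k}\mathbf{s}(\mathbf{X}_{jl_j}-\mathbf{X}_{kl_k})\Big),$$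 and $\widehat{\boldsymbol{\Sigma}}_n=(\boldsymbol{\sigma}^{(n)}_{k_1k_2})_{K\times K}$ with $$\boldsymbol{\sigma}^{(n)}_{k_1k_2}=\frac{\sqrt{n_{k_1}n_{k_2}}}{n}\sum_{l=1}^K\frac{n_l}{n}[\mathbf{C}_n(k_1,k_2,l)-\mathbf{C}_n(l,k_2,k_1)-\mathbf{C}_n(k_1,l,k_2)]+\sum_{l_1=1}^K\sum_{l_2=1}^K\frac{n_{l_1}n_{l_2}}{n^2}\mathbf{C}_n(l_1,l_2,k_1)\mathbb{I}(k_1=k_2),$$ regarded as the operator on $\mathcal{H}^K$ with bilinear form $(\mathbf{w},\mathbf{v})\mapsto\sum_{k_1,k_2}\langle\boldsymbol{\sigma}^{(n)}_{k_1k_2}\mathbf{w}_{k_1},\mathbf{v}_{k_2}\rangle$ (it is almost surely non-negative definite once all $n_k\ge2$). Bootstrap procedure: given the sample, draw $\mathbf{X}^*_{ki}$ ($k=1,\dots,K$, $i=1,\dots,n_k$) independent and identically distributed, uniformly from the $n$ observations of the pooled sample (with replacement), and let $SS_n^*$ be the statistic $SS_n$ computed from $\{\mathbf{X}^*_{ki}\}$. Repeat $M_b$ times independently; the p-value is the proportion of the $M_b$ values $SS_n^*$ that are higher than $SS_n$. Permutation procedure: given the sample, take a uniformly random permutation of the pooled sample, assign the first $n_1$ elements to group 1, the next $n_2$ to group 2, and so on, and let $SS_n^{\#}$ be the statistic computed from this permuted sample. Repeat $M_p$ times independently; the p-value is the proportion of the $M_p$ values $SS_n^{\#}$ that are higher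 than $SS_n$. *)

theory Defs
  imports "HOL-Analysis.Analysis" "HOL-Probability.Probability"
begin

text \<open>
  The separable Hilbert space is a type \<open>'a\<close> of class
  \<open>{real_inner, banach, second_countable_topology}\<close>. The groups are the elements of a finite
  type \<open>'k\<close>, so that the product Hilbert space with \<open>K = CARD('k)\<close> factors is the type
  \<open>'a ^ 'k\<close>, whose norm and inner product are the Hilbert sum ones. The library lacks only
  the following instance for it; it is needed for the Bochner integral.
\<close>

instance vec :: ("{metric_space, second_countable_topology}", finite) second_countable_topology
proof
  obtain B :: "'a set set" where B: "countable B" "topological_basis B"
    using ex_countable_basis by blast
  define P :: "('b \<Rightarrow> 'a set) \<Rightarrow> ('a ^ 'b) set" where "P F = {y. \<forall>i. y $ i \<in> F i}" for F
  define C where "C = P ` (Pi\<^sub>E UNIV (\<lambda>_. B))"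
  have "countable C"
    unfolding C_def using B(1) by (intro countable_image countable_PiE) auto
  moreover have "topological_basis C"
  proof (rule topological_basisI)
    fix U assume "U \<in> C"
    then obtain F where F: "U = P F" "\<And>i. F i \<in> B" by (auto simp: C_def PiE_def Pi_def)
    then have "\<And>i. open (F i)" using B(2) topological_basis_open by blast
    then show "open U" unfolding F(1) P_def by (auto simp: open_vec_def)
  next
    fix S :: "('a ^ 'b) set" and x assume S: "open S" "x \<in> S"
    then obtain A where A: "\<And>i. open (A i) \<and> x $ i \<in> A i" "\<And>y. (\<forall>i. y $ i \<in> A i) \<Longrightarrow> y \<in> S"
      unfolding open_vec_def by metis
    have "\<forall>i. \<exists>F\<in>B. x $ i \<in> F \<and> F \<subseteq> A i"
      using topological_basisE[OF B(2)] A(1) by metis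
    then obtain F where F: "\<And>i. F i \<in> B" "\<And>i. x $ i \<in> F i" "\<And>i. F i \<subseteq> A i" by metis
    have "P F \<in> C" unfolding C_def using F(1) by auto
    moreover have "x \<in> P F" using F(2) by (auto simp: P_def)
    moreover have "P F \<subseteq> S" unfolding P_def using F(3) A(2) by (metis (mono_tags, lifting) mem_Collect_eq subset_iff)
    ultimately show "\<exists>U\<in>C. x \<in> U \<and> U \<subseteq> S" by blast
  qed
  ultimately show "\<exists>C::('a ^ 'b) set set. countable C \<and> open = generate_topology C"
    using topological_basis_imp_subbasis by blast
qed


text \<open>
  Throughout, \<open>N k\<close> is the size of group \<open>k\<close> and \<open>x k i\<close>, for \<open>i < N k\<close>, are the
  observations of group \<open>k\<close> (numbered from 0; the values \<open>x k i\<close> with \<open>i \<ge> N k\<close> are not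
  used). The spatial sign function is the library function \<^const>\<open>sgn\<close>, since
  \<open>sgn x = x /\<^sub>R norm x\<close> in a normed space, with value \<open>0\<close> at \<open>0\<close>.
\<close>

definition total_size :: "('k::finite \<Rightarrow> nat) \<Rightarrow> nat" where
  "total_size N = (\<Sum>k\<in>UNIV. N k)"

definition spatial_rank ::
    "('k::finite \<Rightarrow> nat) \<Rightarrow> ('k \<Rightarrow> nat \<Rightarrow> 'a::real_normed_vector) \<Rightarrow> 'a \<Rightarrow> 'a" where
  "spatial_rank N x y = (1 / real (total_size N)) *\<^sub>R (\<Sum>k\<in>UNIV. \<Sum>i<N k. sgn (y - x k i))"

definition mean_rank ::
    "('k::finite \<Rightarrow> nat) \<Rightarrow> ('k \<Rightarrow> nat \<Rightarrow> 'a::real_normed_vector) \<Rightarrow> 'k \<Rightarrow> 'a" where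
  "mean_rank N x k = (1 / real (N k)) *\<^sub>R (\<Sum>i<N k. spatial_rank N x (x k i))"

definition rank_vector ::
    "('k::finite \<Rightarrow> nat) \<Rightarrow> ('k \<Rightarrow> nat \<Rightarrow> 'a::real_inner) \<Rightarrow> 'a ^ 'k" where
  "rank_vector N x = (\<chi> k. sqrt (real (N k)) *\<^sub>R mean_rank N x k)"

definition SS :: "('k::finite \<Rightarrow> nat) \<Rightarrow> ('k \<Rightarrow> nat \<Rightarrow> 'a::real_inner) \<Rightarrow> real" where
  "SS N x = (norm (rank_vector N x))\<^sup>2"


subsection \<open>Asymptotic procedure\<close>

definition tensor :: "'a::real_inner \<Rightarrow> 'a \<Rightarrow> 'a \<Rightarrow>\<^sub>L 'a" where
  "tensor x y = blinfun_scaleR_left y o\<^sub>L blinfun_inner_left x"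

lemma tensor_apply: "blinfun_apply (tensor x y) w = (w \<bullet> x) *\<^sub>R y"
  by (simp add: tensor_def)

definition C_op ::
    "('k::finite \<Rightarrow> nat) \<Rightarrow> ('k \<Rightarrow> nat \<Rightarrow> 'a::real_inner) \<Rightarrow> 'k \<Rightarrow> 'k \<Rightarrow> 'k \<Rightarrow> 'a \<Rightarrow>\<^sub>L 'a" where
  "C_op N x i j k =
     (1 / (real (N k) - 1)) *\<^sub>R
       (\<Sum>m<N k. tensor ((1 / real (N i)) *\<^sub>R (\<Sum>p<N i. sgn (x i p - x k m)))
                       ((1 / real (N j)) *\<^sub>R (\<Sum>q<N j. sgn (x j q - x k m))))
     - tensor ((1 / (real (N i) * real (N k))) *\<^sub>R (\<Sum>p<N i. \<Sum>m<N k. sgn (x i p - x k m)))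
              ((1 / (real (N j) * real (N k))) *\<^sub>R (\<Sum>q<N j. \<Sum>m<N k. sgn (x j q - x k m)))"

definition sigma_block ::
    "('k::finite \<Rightarrow> nat) \<Rightarrow> ('k \<Rightarrow> nat \<Rightarrow> 'a::real_inner) \<Rightarrow> 'k \<Rightarrow> 'k \<Rightarrow> 'a \<Rightarrow>\<^sub>L 'a" where
  "sigma_block N x k1 k2 =
     (sqrt (real (N k1) * real (N k2)) / real (total_size N)) *\<^sub>R
       (\<Sum>l\<in>UNIV. (real (N l) / real (total_size N)) *\<^sub>R
          (C_op N x k1 k2 l - C_op N x l k2 k1 - C_op N x k1 l k2))
     + (if k1 = k2 then
          \<Sum>l1\<in>UNIV. \<Sum>l2\<in>UNIV.
            (real (N l1) * real (N l2) / (real (total_size N))\<^sup>2) *\<^sub>R C_op N x l1 l2 k1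
        else 0)"

text \<open>The operator with bilinear form
  \<open>(w, v) \<mapsto> (\<Sum>k1 k2. (\<sigma>\<^bsub>k1 k2\<^esub> w\<^bsub>k1\<^esub>) \<bullet> v\<^bsub>k2\<^esub>)\<close>: the first block index belongs to the argument.\<close>

definition Sigma_op ::
    "('k::finite \<Rightarrow> nat) \<Rightarrow> ('k \<Rightarrow> nat \<Rightarrow> 'a::real_inner) \<Rightarrow> 'a ^ 'k \<Rightarrow> 'a ^ 'k" where
  "Sigma_op N x w = (\<chi> k2. \<Sum>k1\<in>UNIV. blinfun_apply (sigma_block N x k1 k2) (w $ k1))"

lemma Sigma_op_form:
  "Sigma_op N x w \<bullet> v =
     (\<Sum>k1\<in>UNIV. \<Sum>k2\<in>UNIV. blinfun_apply (sigma_block N x k1 k2) (w $ k1) \<bullet> (v $ k2))"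
  by (subst sum.swap) (simp add: Sigma_op_def inner_vec_def inner_sum_left)

text \<open>Normal laws on the line, point masses included.\<close>

definition real_gaussian_law :: "real measure \<Rightarrow> bool" where
  "real_gaussian_law Q \<longleftrightarrow>
     (\<exists>\<mu>. Q = return borel \<mu>) \<or>
     (\<exists>\<mu> \<sigma>. \<sigma> > 0 \<and> Q = density lborel (\<lambda>t. ennreal (normal_density \<mu> \<sigma> t)))"

text \<open>\<open>Q\<close> is the law of a Gaussian random element with mean \<open>m\<close> and covariance operator \<open>S\<close>.\<close>

definition gaussian_law ::
    "('b::{real_inner, banach, second_countable_topology}) measure \<Rightarrow> 'b \<Rightarrow> ('b \<Rightarrow> 'b) \<Rightarrow> bool" where
  "gaussian_law Q m S \<longleftrightarrow>
     prob_space Q \<and> sets Q = sets borel \<and>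
     (\<forall>v. real_gaussian_law (distr Q borel (\<lambda>w. w \<bullet> v))) \<and>
     (\<forall>v. (\<integral>w. w \<bullet> v \<partial>Q) = m \<bullet> v) \<and>
     (\<forall>u v. (\<integral>w. ((w - m) \<bullet> u) * ((w - m) \<bullet> v) \<partial>Q) = S u \<bullet> v)"

text \<open>
  A Gaussian law is determined by its mean and covariance operator, so the choice operator
  below picks the law given the sample whenever all group sizes are at least 2; for smaller
  group sizes the value is irrelevant to a limit statement.
\<close>

definition asymptotic_pvalue ::
    "('k::finite \<Rightarrow> nat) \<Rightarrow> ('k \<Rightarrow> nat \<Rightarrow> 'a::{real_inner, banach, second_countable_topology}) \<Rightarrow> real"
  where
  "asymptotic_pvalue N x =
     measure (SOME Q. gaussian_law Q 0 (Sigma_op N x)) {w. (norm w)\<^sup>2 \<ge> SS N x}"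


subsection \<open>Resampling procedures\<close>

text \<open>
  The pooled sample is indexed by the pairs \<open>(k, i)\<close> with \<open>i < N k\<close>. A resample is described by
  a map \<open>f\<close> of indices: the new observation in place \<open>(k, i)\<close> is the original one with index
  \<open>f (k, i)\<close>.
\<close>

definition pooled_index :: "('k::finite \<Rightarrow> nat) \<Rightarrow> ('k \<times> nat) set" where
  "pooled_index N = (SIGMA k:UNIV. {..<N k})"

definition resample ::
    "('k \<Rightarrow> nat \<Rightarrow> 'a) \<Rightarrow> ('k \<times> nat \<Rightarrow> 'k \<times> nat) \<Rightarrow> 'k \<Rightarrow> nat \<Rightarrow> 'a" where
  "resample x f k i = (case f (k, i) of (l, j) \<Rightarrow> x l j)"

text \<open>Bootstrap: the indices are drawn independently and uniformly (the first two arguments of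
  \<^const>\<open>Pi_pmf\<close> are the index set and the irrelevant value outside it).\<close>

definition bootstrap_pmf :: "('k::finite \<Rightarrow> nat) \<Rightarrow> ('k \<times> nat \<Rightarrow> 'k \<times> nat) pmf" where
  "bootstrap_pmf N = Pi_pmf (pooled_index N) undefined (\<lambda>_. pmf_of_set (pooled_index N))"

text \<open>Permutation: listing the index pairs group by group identifies the places
  of the first \<open>n\<^sub>1\<close> elements with group 1, of the next \<open>n\<^sub>2\<close> with group 2, and so on.\<close>

definition permutation_pmf :: "('k::finite \<Rightarrow> nat) \<Rightarrow> ('k \<times> nat \<Rightarrow> 'k \<times> nat) pmf" where
  "permutation_pmf N = pmf_of_set {\<pi>. \<pi> permutes pooled_index N}"

definition resampling_pvalue ::
    "('k::finite \<Rightarrow> nat) \<Rightarrow> ('k \<Rightarrow> nat \<Rightarrow> 'a::real_inner) \<Rightarrow> nat \<Rightarrow>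
     (nat \<Rightarrow> 'k \<times> nat \<Rightarrow> 'k \<times> nat) \<Rightarrow> real" where
  "resampling_pvalue N x B d =
     real (card {b. b < B \<and> SS N (resample x (d b)) > SS N x}) / real B"

text \<open>Conditional probability, given the sample \<open>x\<close>, that the level \<open>\<alpha>\<close> test with \<open>B\<close> independent
  resamples, each described by an index map with law \<open>D\<close>, rejects.\<close>

definition resampling_rejection_prob ::
    "('k::finite \<times> nat \<Rightarrow> 'k \<times> nat) pmf \<Rightarrow> real \<Rightarrow> ('k \<Rightarrow> nat) \<Rightarrow> nat \<Rightarrow>
     ('k \<Rightarrow> nat \<Rightarrow> 'a::real_inner) \<Rightarrow> real" where
  "resampling_rejection_prob D \<alpha> N B x =
     measure_pmf.prob (Pi_pmf {..<B} undefined (\<lambda>_. D)) {d. resampling_pvalue N x B d \<le> \<alpha>}"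

end

theory Submission
  imports Defs
begin

text \<open>
  Each procedure compares \<^term>\<open>SS N x\<close> with a reference distribution whose mean is bounded by
  a constant depending only on the number of groups, whatever the sample \<open>x\<close> is. By Markov's
  inequality the p-values are then \<open>O(1 / SS N x)\<close>, so everything follows from \<open>SS \<rightarrow> \<infinity>\<close> in
  probability; that in turn is Chebyshev's inequality for one component of the rank vector, whose
  mean grows like the square root of the sample size while its variance stays bounded.

  The mean of the resampled statistic is bounded because exchanging two places leaves the
  resampling law unchanged but reverses a sign, so that summands without a common index are
  uncorrelated. The operator \<^term>\<open>Sigma_op N x\<close> is an explicit sum of rank one operators with
  bounded trace. Uniqueness of the Gaussian law is what makes the p-value of the asymptotic
  procedure a measurable function of the sample.
\<close>

subsection \<open>Second moments of rank sums\<close>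

text \<open>Boundedness of the variances comes from counting. A component of the rank vector is a
  normalised sum of signs over pairs of observations from two different groups. Among pairs of such
  summands only those with a common index contribute, a fraction of order \<open>1 / n\<close> when
  the groups are comparable, and this compensates the square of the factor
  \<open>sqrt (N k)\<close>. The count rests on uncorrelatedness alone, so it serves independent
  observations and exchangeable resamples alike.

  For the asymptotic procedure the obstacle is the choice operator, which says nothing about how the
  reference law depends on the sample. Realising the law on a fixed product of standard normals with
  sample dependent coefficients supplies existence and joint measurability. That the chosen law is
  this one is a uniqueness statement in a possibly infinite dimensional space; there Levy's theorem
  on the line is applied one direction at a time, the earlier directions being carried along as a
  weight.

  The bounds in terms of \<open>SS\<close> are uniform in the sample and in the number of resamples,
  so the double limit can be taken without relating \<open>n\<close> and \<open>B\<close>.\<close>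

lemma borel_measurable_sgn_vector [measurable]:
  "(sgn :: 'a::{real_normed_vector, second_countable_topology} \<Rightarrow> 'a) \<in> borel_measurable borel"
  unfolding sgn_div_norm[abs_def] by measurable

lemma norm_sgn_le_1: "norm (sgn (x :: 'a::real_normed_vector)) \<le> 1"
  by (simp add: norm_sgn)

lemma sgn_minus_commute: "sgn (y - x :: 'a::real_normed_vector) = - sgn (x - y)"
  by (metis minus_diff_eq sgn_minus)

lemma norm_sum_squared_le:
  fixes a :: "'i \<Rightarrow> 'a::real_normed_vector"
  assumes "finite I"
  shows "(norm (\<Sum>i\<in>I. a i))\<^sup>2 \<le> real (card I) * (\<Sum>i\<in>I. (norm (a i))\<^sup>2)"
proof -
  have "(norm (\<Sum>i\<in>I. a i))\<^sup>2 \<le> (\<Sum>i\<in>I. norm (a i))\<^sup>2"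
    by (intro power_mono norm_sum) auto
  also have "\<dots> \<le> real (card I) * (\<Sum>i\<in>I. (norm (a i))\<^sup>2)"
    using sum_squared_le_sum_of_squares[of "\<lambda>i. norm (a i)" I] by (simp add: mult.commute)
  finally show ?thesis .
qed

lemma (in finite_measure) integrable_bounded:
  fixes f :: "'a \<Rightarrow> 'b::{banach, second_countable_topology}"
  assumes "f \<in> borel_measurable M" and "\<And>x. norm (f x) \<le> b"
  shows "integrable M f"
  using assms by (intro integrable_const_bound[where B = b]) auto

text \<open>Expanding the square gives a sum over quadruples in which only those with
  \<open>i = i'\<close> or \<open>j = j'\<close> survive, each at most \<open>b\<^sup>2\<close>;
  there are at most \<open>card I * card J * (card I + card J)\<close> of them. The hypothesis is
  orthogonality in the mean rather than independence, so that exchangeable resamples are covered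
  too.\<close>

lemma second_moment_double_sum:
  fixes h :: "'i \<Rightarrow> 'j \<Rightarrow> 'w \<Rightarrow> 'a::{real_inner, second_countable_topology}"
  assumes M: "prob_space M" and fin: "finite I" "finite J"
    and meas: "\<And>i j. i \<in> I \<Longrightarrow> j \<in> J \<Longrightarrow> h i j \<in> borel_measurable M"
    and bound: "\<And>i j \<omega>. norm (h i j \<omega>) \<le> b"
    and uncorr: "\<And>i j i' j'. i \<in> I \<Longrightarrow> i' \<in> I \<Longrightarrow> j \<in> J \<Longrightarrow> j' \<in> J \<Longrightarrow> i \<noteq> i' \<Longrightarrow> j \<noteq> j' \<Longrightarrow>
       (\<integral>\<omega>. h i j \<omega> \<bullet> h i' j' \<omega> \<partial>M) = 0"
  shows "(\<integral>\<omega>. (norm (\<Sum>i\<in>I. \<Sum>j\<in>J. h i j \<omega>))\<^sup>2 \<partial>M)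
           \<le> b\<^sup>2 * (real (card I) * real (card J)) * (real (card I) + real (card J))"
proof -
  interpret prob_space M by fact
  have inner_bound: "\<bar>h i j \<omega> \<bullet> h i' j' \<omega>\<bar> \<le> b\<^sup>2" for i j i' j' \<omega>
  proof -
    have "\<bar>h i j \<omega> \<bullet> h i' j' \<omega>\<bar> \<le> norm (h i j \<omega>) * norm (h i' j' \<omega>)"
      by (rule Cauchy_Schwarz_ineq2)
    also have "\<dots> \<le> b * b"
      using bound by (intro mult_mono) (auto intro: order_trans[OF norm_ge_zero bound])
    finally show ?thesis by (simp add: power2_eq_square)
  qed
  have int: "integrable M (\<lambda>\<omega>. h i j \<omega> \<bullet> h i' j' \<omega>)"
    if "i \<in> I" "j \<in> J" "i' \<in> I" "j' \<in> J" for i j i' j'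
    using that inner_bound[of i j _ i' j'] meas
    by (intro integrable_bounded[where b = "b\<^sup>2"] borel_measurable_inner) auto
  \<comment> \<open>Adding the two indicators counts the diagonal twice, but lets the fourfold sum
    factor.\<close>
  have le: "(\<integral>\<omega>. h i j \<omega> \<bullet> h i' j' \<omega> \<partial>M)
      \<le> (if i = i' then b\<^sup>2 else 0) + (if j = j' then b\<^sup>2 else 0)"
    if ij: "i \<in> I" "j \<in> J" "i' \<in> I" "j' \<in> J" for i j i' j'
  proof (cases "i \<noteq> i' \<and> j \<noteq> j'")
    case False
    have "(\<integral>\<omega>. h i j \<omega> \<bullet> h i' j' \<omega> \<partial>M) \<le> (\<integral>\<omega>. b\<^sup>2 \<partial>M)"
      using int[OF ij] inner_bound[of i j _ i' j'] by (intro integral_mono) (auto simp: abs_le_iff)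
    also have "\<dots> = b\<^sup>2" by (simp add: prob_space)
    finally show ?thesis using False zero_le_power2[of b] by (auto intro: order_trans)
  qed (use uncorr ij in auto)
  have "(\<integral>\<omega>. (norm (\<Sum>i\<in>I. \<Sum>j\<in>J. h i j \<omega>))\<^sup>2 \<partial>M)
      = (\<integral>\<omega>. (\<Sum>i\<in>I. \<Sum>j\<in>J. \<Sum>i'\<in>I. \<Sum>j'\<in>J. h i j \<omega> \<bullet> h i' j' \<omega>) \<partial>M)"
    unfolding power2_norm_eq_inner inner_sum_left unfolding inner_sum_right ..
  also have "\<dots> = (\<Sum>i\<in>I. \<Sum>j\<in>J. \<Sum>i'\<in>I. \<Sum>j'\<in>J. (\<integral>\<omega>. h i j \<omega> \<bullet> h i' j' \<omega> \<partial>M))"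
    using int by (simp add: Bochner_Integration.integral_sum)
  also have "\<dots> \<le> (\<Sum>i\<in>I. \<Sum>j\<in>J. \<Sum>i'\<in>I. \<Sum>j'\<in>J.
      (if i = i' then b\<^sup>2 else 0) + (if j = j' then b\<^sup>2 else 0))"
    using le by (intro sum_mono) auto
  also have "\<dots> = (\<Sum>i\<in>I. \<Sum>j\<in>J. real (card J) * b\<^sup>2 + real (card I) * b\<^sup>2)"
    using fin by (intro sum.cong) (simp_all add: sum.distrib sum_distrib_left[symmetric])
  also have "\<dots> = b\<^sup>2 * (real (card I) * real (card J)) * (real (card I) + real (card J))"
    by (simp add: algebra_simps)
  finally show ?thesis .
qed

lemma sum_sgn_diff_eq_0:
  fixes a :: "'i \<Rightarrow> 'a::real_normed_vector"
  shows "(\<Sum>i\<in>I. \<Sum>j\<in>I. sgn (a i - a j)) = 0"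
proof -
  have "(\<Sum>i\<in>I. \<Sum>j\<in>I. sgn (a i - a j)) = (\<Sum>j\<in>I. \<Sum>i\<in>I. sgn (a i - a j))"
    by (rule sum.swap)
  also have "\<dots> = - (\<Sum>i\<in>I. \<Sum>j\<in>I. sgn (a i - a j))"
    by (subst sgn_minus_commute) (simp add: sum_negf)
  finally have "(2::real) *\<^sub>R (\<Sum>i\<in>I. \<Sum>j\<in>I. sgn (a i - a j)) = 0"
    by (simp only: scaleR_2 eq_neg_iff_add_eq_0)
  then show ?thesis by simp
qed

text \<open>The within-group block drops out because \<open>sgn\<close> is odd. This matters for the
  counting: inside one group both indices run over the same observations, so
  \<open>i \<noteq> i'\<close> and \<open>j \<noteq> j'\<close> would not make two summands free of
  common observations.\<close>

lemma mean_rank_eq: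
  "mean_rank N x k = (\<Sum>l\<in>UNIV - {k}. (1 / (real (total_size N) * real (N k))) *\<^sub>R
      (\<Sum>i<N k. \<Sum>j<N l. sgn (x k i - x l j)))"
proof -
  have "mean_rank N x k = (1 / (real (total_size N) * real (N k))) *\<^sub>R
      (\<Sum>i<N k. \<Sum>l\<in>UNIV. \<Sum>j<N l. sgn (x k i - x l j))"
    by (simp add: mean_rank_def spatial_rank_def scaleR_sum_right[symmetric] mult.commute)
  also have "(\<Sum>i<N k. \<Sum>l\<in>UNIV. \<Sum>j<N l. sgn (x k i - x l j))
      = (\<Sum>l\<in>UNIV. \<Sum>i<N k. \<Sum>j<N l. sgn (x k i - x l j))"
    by (rule sum.swap)
  also have "\<dots> = (\<Sum>l\<in>UNIV - {k}. \<Sum>i<N k. \<Sum>j<N l. sgn (x k i - x l j))"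
    by (subst sum.remove[of UNIV k]) (simp_all add: sum_sgn_diff_eq_0)
  finally show ?thesis by (simp add: scaleR_sum_right)
qed

lemma SS_eq: "SS N x = (\<Sum>k\<in>UNIV. (norm (sqrt (real (N k)) *\<^sub>R mean_rank N x k))\<^sup>2)"
  by (simp add: SS_def rank_vector_def norm_vec_def L2_set_def sum_nonneg)

text \<open>Cauchy-Schwarz over the groups costs the factor \<open>CARD('k)\<close>. For one
  \<open>l\<close>, the double sum bound times \<open>N k / (n * N k)\<^sup>2\<close> is at most
  \<open>b\<^sup>2 * N l / n\<close>, where \<open>n\<close> is the total size, since
  \<open>N k + N l \<le> n\<close> for \<open>l \<noteq> k\<close>. These proportions sum to at most
  1, which leaves a bound free of all group sizes.\<close>

lemma second_moment_group:
  fixes h :: "'k::finite \<Rightarrow> nat \<Rightarrow> nat \<Rightarrow> 'w \<Rightarrow> 'a::{real_inner, second_countable_topology}"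
  assumes M: "prob_space M"
    and meas: "\<And>l i j. l \<noteq> k \<Longrightarrow> h l i j \<in> borel_measurable M"
    and bound: "\<And>l i j \<omega>. norm (h l i j \<omega>) \<le> b"
    and uncorr: "\<And>l i j i' j'. l \<noteq> k \<Longrightarrow> i < N k \<Longrightarrow> i' < N k \<Longrightarrow> j < N l \<Longrightarrow> j' < N l \<Longrightarrow>
       i \<noteq> i' \<Longrightarrow> j \<noteq> j' \<Longrightarrow> (\<integral>\<omega>. h l i j \<omega> \<bullet> h l i' j' \<omega> \<partial>M) = 0"
  shows "(\<integral>\<omega>. (norm (sqrt (real (N k)) *\<^sub>R (\<Sum>l\<in>UNIV - {k}.
            (1 / (real (total_size N) * real (N k))) *\<^sub>R
              (\<Sum>i<N k. \<Sum>j<N l. h l i j \<omega>))))\<^sup>2 \<partial>M) \<le> b\<^sup>2 * real CARD('k)"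
proof (cases "N k = 0")
  case False
  interpret prob_space M by fact
  let ?n = "real (total_size N)" and ?K = "real CARD('k)"
  define c where "c = 1 / (?n * real (N k))"
  define T where "T l \<omega> = (\<Sum>i<N k. \<Sum>j<N l. h l i j \<omega>)" for l \<omega>
  have Tm [measurable]: "T l \<in> borel_measurable M" if "l \<noteq> k" for l
    unfolding T_def using meas that by (intro borel_measurable_sum) auto
  have Tb: "norm (T l \<omega>) \<le> real (N k) * (real (N l) * b)" for l \<omega>
    unfolding T_def using bound
    by (auto intro!: sum_norm_le[THEN order_trans] sum_bounded_above[THEN order_trans])
  have Ti: "integrable M (\<lambda>\<omega>. (norm (T l \<omega>))\<^sup>2)" if "l \<noteq> k" for l
    using that Tb[of l] by (intro integrable_bounded[where b = "(real (N k) * (real (N l) * b))\<^sup>2"])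
       (auto intro!: power_mono)
  have npos: "?n > 0"
    using False unfolding total_size_def by (metis UNIV_I finite_code gr0I of_nat_0_less_iff sum_eq_0_iff)
  have pair: "real (N k) + real (N l) \<le> ?n" if "l \<noteq> k" for l
  proof -
    have "(\<Sum>i\<in>{k,l}. N i) \<le> total_size N"
      unfolding total_size_def by (intro sum_mono2) auto
    then have "N k + N l \<le> total_size N" using that by simp
    then show ?thesis by linarith
  qed
  have pointwise: "(norm (sqrt (real (N k)) *\<^sub>R (\<Sum>l\<in>UNIV - {k}. c *\<^sub>R T l \<omega>)))\<^sup>2
      \<le> (\<Sum>l\<in>UNIV - {k}. real (N k) * ?K * c\<^sup>2 * (norm (T l \<omega>))\<^sup>2)" for \<omega>
  proof -
    have "(norm (sqrt (real (N k)) *\<^sub>R (\<Sum>l\<in>UNIV - {k}. c *\<^sub>R T l \<omega>)))\<^sup>2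
        = real (N k) * (norm (\<Sum>l\<in>UNIV - {k}. c *\<^sub>R T l \<omega>))\<^sup>2"
      by (simp add: power_mult_distrib)
    also have "\<dots> \<le> real (N k) * (?K * (\<Sum>l\<in>UNIV - {k}. (norm (c *\<^sub>R T l \<omega>))\<^sup>2))"
      by (intro mult_left_mono norm_sum_squared_le[THEN order_trans] mult_right_mono sum_nonneg)
         (auto simp: card_Diff_subset)
    also have "\<dots> = (\<Sum>l\<in>UNIV - {k}. real (N k) * ?K * c\<^sup>2 * (norm (T l \<omega>))\<^sup>2)"
      by (simp add: sum_distrib_left power_mult_distrib mult_ac)
    finally show ?thesis .
  qed
  have "(\<integral>\<omega>. (norm (sqrt (real (N k)) *\<^sub>R (\<Sum>l\<in>UNIV - {k}. c *\<^sub>R T l \<omega>)))\<^sup>2 \<partial>M)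
      \<le> (\<integral>\<omega>. (\<Sum>l\<in>UNIV - {k}. real (N k) * ?K * c\<^sup>2 * (norm (T l \<omega>))\<^sup>2) \<partial>M)"
    using pointwise Ti
    by (intro integral_mono' Bochner_Integration.integrable_sum integrable_mult_right)
       (auto intro!: sum_nonneg simp del: norm_scaleR)
  also have "\<dots> = (\<Sum>l\<in>UNIV - {k}. real (N k) * ?K * c\<^sup>2 * (\<integral>\<omega>. (norm (T l \<omega>))\<^sup>2 \<partial>M))"
    using Ti by (subst Bochner_Integration.integral_sum) auto
  also have "\<dots> \<le> (\<Sum>l\<in>UNIV - {k}. b\<^sup>2 * ?K * (real (N l) / ?n))"
  proof (intro sum_mono)
    fix l assume "l \<in> UNIV - {k}"
    then have l: "l \<noteq> k" by simp
    have "(\<integral>\<omega>. (norm (T l \<omega>))\<^sup>2 \<partial>M) \<le> b\<^sup>2 * (real (N k) * real (N l)) * (real (N k) + real (N l))"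
      unfolding T_def
      using second_moment_double_sum[OF M finite_lessThan[of "N k"] finite_lessThan[of "N l"],
          of "h l" b] meas bound uncorr l by auto
    also have "\<dots> \<le> b\<^sup>2 * (real (N k) * real (N l)) * ?n"
      using pair[OF l] by (intro mult_left_mono) auto
    finally have "real (N k) * ?K * c\<^sup>2 * (\<integral>\<omega>. (norm (T l \<omega>))\<^sup>2 \<partial>M)
        \<le> real (N k) * ?K * c\<^sup>2 * (b\<^sup>2 * (real (N k) * real (N l)) * ?n)"
      by (intro mult_left_mono) auto
    also have "\<dots> = b\<^sup>2 * ?K * (real (N l) / ?n)"
      using False npos by (simp add: c_def power2_eq_square field_simps)
    finally show "real (N k) * ?K * c\<^sup>2 * (\<integral>\<omega>. (norm (T l \<omega>))\<^sup>2 \<partial>M)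
        \<le> b\<^sup>2 * ?K * (real (N l) / ?n)" .
  qed
  also have "\<dots> = b\<^sup>2 * ?K * ((\<Sum>l\<in>UNIV - {k}. real (N l)) / ?n)"
    by (simp add: sum_distrib_left sum_divide_distrib)
  also have "\<dots> \<le> b\<^sup>2 * ?K * 1"
  proof (intro mult_left_mono)
    have "(\<Sum>l\<in>UNIV - {k}. real (N l)) \<le> (\<Sum>l\<in>UNIV. real (N l))"
      by (intro sum_mono2) auto
    then show "(\<Sum>l\<in>UNIV - {k}. real (N l)) / ?n \<le> 1"
      using npos by (simp add: total_size_def)
  qed auto
  finally show ?thesis by (simp add: c_def T_def)
qed simp

text \<open>Closure of \<open>S\<close> under exchanging two places is the property shared by
  permutations and draws with replacement; it makes the uniform law on \<open>S\<close> invariant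
  under the exchange. The sample is fixed and arbitrary, so the bound is the same under the null
  hypothesis and under the alternative: \<open>CARD('k)\<close> groups contribute at most
  \<open>CARD('k)\<close> each.\<close>

lemma resample_second_moment:
  fixes x :: "'k::finite \<Rightarrow> nat \<Rightarrow> 'a::{real_inner, second_countable_topology}"
  assumes S: "finite S" "S \<noteq> {}"
    and closed: "\<And>f p q. f \<in> S \<Longrightarrow> p \<in> pooled_index N \<Longrightarrow> q \<in> pooled_index N \<Longrightarrow>
      f \<circ> Transposition.transpose p q \<in> S"
  shows "(\<integral>f. SS N (resample x f) \<partial>measure_pmf (pmf_of_set S)) \<le> (real CARD('k))\<^sup>2"
proof -
  let ?D = "measure_pmf (pmf_of_set S)"
  define y where "y f = (\<lambda>(l, j). x l j) \<circ> f" for f :: "'k \<times> nat \<Rightarrow> 'k \<times> nat"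
  have yr: "resample x f k i = y f (k, i)" for f k i
    by (simp add: resample_def y_def case_prod_beta)
  have D_int: "integrable ?D g" for g :: "('k \<times> nat \<Rightarrow> 'k \<times> nat) \<Rightarrow> real"
    using S by (intro integrable_measure_pmf_finite) simp
  text \<open>Exchanging the resampled observations in places \<open>p\<close> and \<open>q\<close> changes the sign of the first
    factor only.\<close>
  have uncorr: "(\<integral>f. sgn (y f p - y f q) \<bullet> sgn (y f p' - y f q') \<partial>?D) = 0" (is "(\<integral>f. ?g f \<partial>?D) = 0")
    if pq: "p \<in> pooled_index N" "q \<in> pooled_index N" and ne: "p \<notin> {p', q'}" "q \<notin> {p', q'}"
    for p q p' q'
  proof -
    let ?t = "\<lambda>f. f \<circ> Transposition.transpose p q"
    have invol: "?t (?t f) = f" for f :: "'k \<times> nat \<Rightarrow> 'k \<times> nat"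
      by (simp add: comp_assoc)
    have "bij_betw ?t S S"
      by (rule bij_betwI[where g = ?t]) (use closed pq invol in auto)
    then have "(\<Sum>f\<in>S. ?g f) = (\<Sum>f\<in>S. ?g (?t f))"
      by (intro sum.reindex_bij_betw[symmetric])
    also have "\<dots> = (\<Sum>f\<in>S. - ?g f)"
    proof (intro sum.cong refl)
      fix f
      have "y (?t f) p = y f q" "y (?t f) q = y f p" "y (?t f) p' = y f p'" "y (?t f) q' = y f q'"
        using ne by (auto simp: y_def Transposition.transpose_def)
      then show "?g (?t f) = - ?g f"
        by (simp add: sgn_minus_commute[of "y f p"])
    qed
    finally have "(\<Sum>f\<in>S. ?g f) = 0" by (simp add: sum_negf)
    then show ?thesis using S by (simp add: integral_pmf_of_set)
  qed
  have "(\<integral>f. SS N (resample x f) \<partial>?D)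
      = (\<Sum>k\<in>UNIV. \<integral>f. (norm (sqrt (real (N k)) *\<^sub>R mean_rank N (resample x f) k))\<^sup>2 \<partial>?D)"
    unfolding SS_eq by (intro Bochner_Integration.integral_sum D_int)
  also have "\<dots> \<le> (\<Sum>k\<in>(UNIV::'k set). 1\<^sup>2 * real CARD('k))"
  proof (intro sum_mono)
    fix k :: 'k
    show "(\<integral>f. (norm (sqrt (real (N k)) *\<^sub>R mean_rank N (resample x f) k))\<^sup>2 \<partial>?D)
        \<le> 1\<^sup>2 * real CARD('k)"
      unfolding mean_rank_eq yr
    proof (rule second_moment_group[where h = "\<lambda>l i j f. sgn (y f (k, i) - y f (l, j))"])
      \<comment> \<open>\<open>l \<noteq> k\<close> separates \<open>(k, i)\<close> from
        \<open>(l, j')\<close> and \<open>(l, j)\<close> from \<open>(k, i')\<close>; the other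
        coincidences are excluded by \<open>i \<noteq> i'\<close> and \<open>j \<noteq> j'\<close>.
        So the exchanged places avoid the second factor.\<close>
      fix l i j i' j' assume "l \<noteq> k" "i < N k" "i' < N k" "j < N l" "j' < N l" "i \<noteq> i'" "j \<noteq> j'"
      then show "(\<integral>f. sgn (y f (k, i) - y f (l, j)) \<bullet> sgn (y f (k, i') - y f (l, j')) \<partial>?D) = 0"
        by (intro uncorr) (auto simp: pooled_index_def)
    qed (auto simp: norm_sgn_le_1 measure_pmf.prob_space_axioms)
  qed
  also have "\<dots> = (real CARD('k))\<^sup>2" by (simp add: power2_eq_square)
  finally show ?thesis .
qed

subsection \<open>Uniqueness of laws with given one-dimensional projections\<close>

text \<open>If the total mass \<open>c\<close> of the weight is positive, \<open>G / c\<close> is a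
  probability density, and the laws of \<open>X\<close> under the two reweighted measures have the
  same characteristic function, so Levy's theorem on the line applies. If \<open>c = 0\<close>, the
  weight vanishes almost everywhere and both sides are 0.\<close>

lemma Levy_uniqueness_weighted:
  fixes G X :: "'b \<Rightarrow> real"
  assumes Q: "prob_space Q1" "prob_space Q2" and sets_eq: "sets Q1 = sets Q2"
    and G [measurable]: "G \<in> borel_measurable Q1" and X [measurable]: "X \<in> borel_measurable Q1"
    and G0: "\<And>w. 0 \<le> G w" and Gb: "\<And>w. G w \<le> b"
    and char_eq: "\<And>t. (CLINT w|Q1. G w *\<^sub>R iexp (t * X w)) = (CLINT w|Q2. G w *\<^sub>R iexp (t * X w))"
    and A [measurable]: "A \<in> sets borel"
  shows "(\<integral>w. G w * indicator A (X w) \<partial>Q1) = (\<integral>w. G w * indicator A (X w) \<partial>Q2)"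
proof -
  interpret Q1: prob_space Q1 by fact
  interpret Q2: prob_space Q2 by fact
  have G2 [measurable]: "G \<in> borel_measurable Q2" and X2 [measurable]: "X \<in> borel_measurable Q2"
    using G X by (simp_all add: measurable_cong_sets[OF sets_eq refl, symmetric])
  have int1: "integrable Q1 G" and int2: "integrable Q2 G"
    using G0 Gb by (auto intro!: Q1.integrable_const_bound[where B = b] Q2.integrable_const_bound[where B = b])
  define c where "c = (\<integral>w. G w \<partial>Q1)"
  \<comment> \<open>At \<open>t = 0\<close> the exponential is 1, so both measures give the weight
    the same mass.\<close>
  have c2: "c = (\<integral>w. G w \<partial>Q2)"
    using char_eq[of 0] by (simp add: c_def scaleR_conv_of_real)
  have c0: "c \<ge> 0" unfolding c_def using G0 by simp
  show ?thesis
  proof (cases "c = 0")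
    case True
    have "AE w in Q1. G w = 0" "AE w in Q2. G w = 0"
      using True c2 c_def G0 int1 int2 integral_nonneg_eq_0_iff_AE by (metis AE_I2)+
    then have "(\<integral>w. G w * indicator A (X w) \<partial>Q1) = 0" "(\<integral>w. G w * indicator A (X w) \<partial>Q2) = 0"
      by (auto intro!: integral_eq_zero_AE)
    then show ?thesis by simp
  next
    case False
    then have c: "c > 0" using c0 by simp
    define D where "D Q = density Q (\<lambda>w. ennreal (G w / c))" for Q
    have prob_D: "prob_space (D Q)" if "integrable Q G" "c = (\<integral>w. G w \<partial>Q)" for Q
    proof
      have "(\<integral>\<^sup>+ w. ennreal (G w / c) \<partial>Q) = ennreal (\<integral>w. G w / c \<partial>Q)"
        using that G0 c by (intro nn_integral_eq_integral) auto
      also have "\<dots> = 1" using that c by simp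
      finally have *: "(\<integral>\<^sup>+ w. ennreal (G w / c) \<partial>Q) = 1" .
      have "G \<in> borel_measurable Q" using that by auto
      then show "emeasure (D Q) (space (D Q)) = 1"
        unfolding D_def using * by (subst emeasure_density) (auto cong: nn_integral_cong)
    qed
    interpret D1: prob_space "D Q1" by (rule prob_D) (auto simp: int1 c_def)
    interpret D2: prob_space "D Q2" by (rule prob_D) (auto simp: int2 c2)
    have [measurable]: "X \<in> borel_measurable (D Q1)" "X \<in> borel_measurable (D Q2)"
      by (simp_all add: D_def)
    have Dint: "(\<integral>w. h w \<partial>(D Q)) = (\<integral>w. (G w / c) *\<^sub>R h w \<partial>Q)"
      if "G \<in> borel_measurable Q" "h \<in> borel_measurable Q" for Q and h :: "'b \<Rightarrow> 'd::{banach, second_countable_topology}"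
      unfolding D_def using that G0 c by (subst integral_density) auto
    have "char (distr (D Q1) borel X) = char (distr (D Q2) borel X)"
    proof
      fix t
      have "char (distr (D Q1) borel X) t = (CLINT w|Q1. (G w / c) *\<^sub>R iexp (t * X w))"
        by (simp add: char_def integral_distr Dint)
      also have "\<dots> = (CLINT w|Q1. (1 / c) *\<^sub>R (G w *\<^sub>R iexp (t * X w)))"
        by simp
      also have "\<dots> = (CLINT w|Q2. (1 / c) *\<^sub>R (G w *\<^sub>R iexp (t * X w)))"
        using char_eq[of t] unfolding integral_scaleR_right by simp
      also have "\<dots> = (CLINT w|Q2. (G w / c) *\<^sub>R iexp (t * X w))"
        by simp
      also have "\<dots> = char (distr (D Q2) borel X) t"
        by (simp add: char_def integral_distr Dint)
      finally show "char (distr (D Q1) borel X) t = char (distr (D Q2) borel X) t" .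
    qed
    then have "distr (D Q1) borel X = distr (D Q2) borel X"
      by (intro Levy_uniqueness D1.real_distribution_distr D2.real_distribution_distr) auto
    note distr_eq = this
    have *: "(\<integral>s. indicat_real A s \<partial>distr (D Q) borel X) = (\<integral>w. G w * indicator A (X w) \<partial>Q) / c"
      if [measurable]: "G \<in> borel_measurable Q" "X \<in> borel_measurable Q" for Q
    proof -
      have "(\<integral>s. indicat_real A s \<partial>distr (D Q) borel X) = (\<integral>w. indicator A (X w) \<partial>D Q)"
        by (rule integral_distr) (simp_all add: D_def that)
      also have "\<dots> = (\<integral>w. (G w / c) *\<^sub>R indicator A (X w) \<partial>Q)"
        by (rule Dint) measurable
      finally show ?thesis by simp
    qed
    have "(\<integral>w. G w * indicator A (X w) \<partial>Q1) / c = (\<integral>w. G w * indicator A (X w) \<partial>Q2) / c"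
      using *[OF G X] *[OF G2 X2] distr_eq by simp
    then show ?thesis using c by simp
  qed
qed

text \<open>The complex weight \<open>exp (\<i> (w \<bullet> v))\<close> is recovered from the nonnegative weights
  \<open>1 + cos (w \<bullet> v + a)\<close>, to which Levy's theorem applies.\<close>
lemma char_functional_localize:
  fixes Q1 Q2 :: "'b::{real_inner, second_countable_topology} measure" and G :: "'b \<Rightarrow> real"
  assumes Q: "prob_space Q1" "prob_space Q2"
    and sets [measurable_cong, simp]: "sets Q1 = sets borel" "sets Q2 = sets borel"
    and G [measurable]: "G \<in> borel_measurable borel"
    and G0: "\<And>w. 0 \<le> G w" and Gb: "\<And>w. G w \<le> b"
    and char_eq: "\<And>v. (CLINT w|Q1. G w *\<^sub>R iexp (w \<bullet> v)) = (CLINT w|Q2. G w *\<^sub>R iexp (w \<bullet> v))"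
    and A [measurable]: "A \<in> sets borel"
  shows "(CLINT w|Q1. (G w * indicator A (w \<bullet> u)) *\<^sub>R iexp (w \<bullet> v))
       = (CLINT w|Q2. (G w * indicator A (w \<bullet> u)) *\<^sub>R iexp (w \<bullet> v))"
proof -
  interpret Q1: prob_space Q1 by fact
  interpret Q2: prob_space Q2 by fact
  have G_iexp: "integrable Q1 (\<lambda>w. G w *\<^sub>R iexp (w \<bullet> v)) \<and> integrable Q2 (\<lambda>w. G w *\<^sub>R iexp (w \<bullet> v))" for v
    using G0 Gb by (intro conjI Q1.integrable_bounded[where b = b] Q2.integrable_bounded[where b = b]) auto
  define E where "E v w = G w *\<^sub>R iexp (w \<bullet> v)" for v w
  have E_int: "integrable Q1 (E v)" "integrable Q2 (E v)"
    and E_eq: "(CLINT w|Q1. E v w) = (CLINT w|Q2. E v w)" for v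
    using G_iexp[of v] char_eq[of v] by (simp_all add: E_def[abs_def])
  \<comment> \<open>By Euler's formula the cosine splits into exponentials, so the weighted
    characteristic function in direction \<open>u\<close> is a combination of the given functional
    at \<open>t *\<^sub>R u\<close>, \<open>t *\<^sub>R u + v\<close> and
    \<open>t *\<^sub>R u - v\<close>.\<close>
  have shifted: "(\<integral>w. G w * (1 + cos (w \<bullet> v + a)) * indicator A (w \<bullet> u) \<partial>Q1)
      = (\<integral>w. G w * (1 + cos (w \<bullet> v + a)) * indicator A (w \<bullet> u) \<partial>Q2)" for v a
  proof (rule Levy_uniqueness_weighted[OF Q])
    show "0 \<le> G w * (1 + cos (w \<bullet> v + a))" for w
      using G0[of w] cos_ge_minus_one[of "w \<bullet> v + a"] by (intro mult_nonneg_nonneg) linarith+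
    show "G w * (1 + cos (w \<bullet> v + a)) \<le> b * 2" for w
      using G0[of w] Gb[of w] cos_le_one[of "w \<bullet> v + a"] cos_ge_minus_one[of "w \<bullet> v + a"]
      by (intro mult_mono; linarith)
    fix t :: real
    have expand: "(G w * (1 + cos (w \<bullet> v + a))) *\<^sub>R iexp (t * (w \<bullet> u))
        = G w *\<^sub>R iexp (w \<bullet> (t *\<^sub>R u))
          + ((iexp a / 2) * (G w *\<^sub>R iexp (w \<bullet> (t *\<^sub>R u + v)))
          + (iexp (- a) / 2) * (G w *\<^sub>R iexp (w \<bullet> (t *\<^sub>R u - v))))" for w
    proof -
      have "complex_of_real (cos (w \<bullet> v + a)) = (iexp (w \<bullet> v + a) + iexp (- (w \<bullet> v + a))) / 2"
        by (simp add: cos_of_real[symmetric] cos_exp_eq algebra_simps)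
      also have "\<dots> = (iexp a * iexp (w \<bullet> v) + iexp (- a) * iexp (- (w \<bullet> v))) / 2"
        by (simp add: exp_add[symmetric] algebra_simps)
      finally have "complex_of_real (cos (w \<bullet> v + a))
          = (iexp a * iexp (w \<bullet> v) + iexp (- a) * iexp (- (w \<bullet> v))) / 2" .
      moreover have "iexp (w \<bullet> (t *\<^sub>R u + v)) = iexp (t * (w \<bullet> u)) * iexp (w \<bullet> v)"
         "iexp (w \<bullet> (t *\<^sub>R u - v)) = iexp (t * (w \<bullet> u)) * iexp (- (w \<bullet> v))"
        by (simp_all add: exp_add[symmetric] algebra_simps inner_add_right inner_diff_right)
      ultimately show ?thesis
        by (simp add: scaleR_conv_of_real algebra_simps add_divide_distrib)
    qed
    show "(CLINT w|Q1. (G w * (1 + cos (w \<bullet> v + a))) *\<^sub>R iexp (t * (w \<bullet> u)))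
        = (CLINT w|Q2. (G w * (1 + cos (w \<bullet> v + a))) *\<^sub>R iexp (t * (w \<bullet> u)))"
      unfolding expand E_def[symmetric] using E_int E_eq by simp
  qed simp_all
  have GA_int: "integrable Q1 (\<lambda>w. G w * indicator A (w \<bullet> u) * k w) \<and> integrable Q2 (\<lambda>w. G w * indicator A (w \<bullet> u) * k w)"
    if "k \<in> borel_measurable borel" "\<And>w. \<bar>k w\<bar> \<le> 1" for k :: "'b \<Rightarrow> real"
  proof (intro conjI Q1.integrable_bounded[where b = b] Q2.integrable_bounded[where b = b])
    show "norm (G w * indicator A (w \<bullet> u) * k w) \<le> b" for w
    proof -
      have "norm (G w * indicator A (w \<bullet> u) * k w) \<le> b * 1 * 1"
        unfolding norm_mult using that G0[of w] Gb[of w]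
        by (intro mult_mono) (auto simp: indicator_def)
      then show ?thesis by simp
    qed
    then show "norm (G w * indicator A (w \<bullet> u) * k w) \<le> b" for w .
  qed (use that in measurable)
  \<comment> \<open>With \<open>v = 0\<close> and \<open>a = pi / 2\<close> the cosine is 0, which
    isolates the plain weight.\<close>
  have base: "(\<integral>w. G w * indicator A (w \<bullet> u) \<partial>Q1) = (\<integral>w. G w * indicator A (w \<bullet> u) \<partial>Q2)"
    using shifted[of 0 "pi / 2"] by simp
  have cos_eq: "(\<integral>w. G w * indicator A (w \<bullet> u) * cos (w \<bullet> v + a) \<partial>Q1)
      = (\<integral>w. G w * indicator A (w \<bullet> u) * cos (w \<bullet> v + a) \<partial>Q2)" for a
  proof -
    have "G w * (1 + cos (w \<bullet> v + a)) * indicator A (w \<bullet> u)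
        = G w * indicator A (w \<bullet> u) * 1 + G w * indicator A (w \<bullet> u) * cos (w \<bullet> v + a)" for w
      by (simp add: algebra_simps)
    then show ?thesis
      using shifted[of v a] base GA_int[of "\<lambda>_. 1"] GA_int[of "\<lambda>w. cos (w \<bullet> v + a)"] by simp
  qed
  have sin_eq: "(\<integral>w. G w * indicator A (w \<bullet> u) * sin (w \<bullet> v) \<partial>Q1)
      = (\<integral>w. G w * indicator A (w \<bullet> u) * sin (w \<bullet> v) \<partial>Q2)"
    using cos_eq[of "- (pi / 2)"] by (simp add: cos_diff)
  have split: "(G w * indicator A (w \<bullet> u)) *\<^sub>R iexp (w \<bullet> v)
      = complex_of_real (G w * indicator A (w \<bullet> u) * cos (w \<bullet> v))
        + \<i> * complex_of_real (G w * indicator A (w \<bullet> u) * sin (w \<bullet> v))" for w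
    by (simp add: exp_Euler cos_of_real sin_of_real scaleR_conv_of_real algebra_simps)
  show ?thesis
    unfolding split using cos_eq[of 0] sin_eq GA_int[of "\<lambda>w. cos (w \<bullet> v)"] GA_int[of "\<lambda>w. sin (w \<bullet> v)"]
    by (simp del: of_real_mult)
qed

section \<open>Cylinder sets and the Borel sets of a separable inner product space\<close>

definition cylinder :: "'b::real_inner set \<Rightarrow> ('b \<Rightarrow> real set) \<Rightarrow> 'b set" where
  "cylinder I A = {w. \<forall>u\<in>I. w \<bullet> u \<in> A u}"

definition cylinders :: "'b::real_inner set set" where
  "cylinders = {cylinder I A |I A. finite I \<and> (\<forall>u. A u \<in> sets borel)}"

lemma Int_stable_cylinders: "Int_stable (cylinders :: 'b::real_inner set set)"
proof (rule Int_stableI)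
  fix a b :: "'b set" assume "a \<in> cylinders" "b \<in> cylinders"
  then obtain I A J B where *: "finite I" "\<And>u. A u \<in> sets borel" "a = cylinder I A"
      "finite J" "\<And>u. B u \<in> sets borel" "b = cylinder J B"
    unfolding cylinders_def by blast
  define C where "C u = (if u \<in> I then A u else UNIV) \<inter> (if u \<in> J then B u else UNIV)" for u
  have "a \<inter> b = cylinder (I \<union> J) C"
    unfolding * by (auto simp: cylinder_def C_def)
  moreover have "C u \<in> sets borel" for u using * by (auto simp: C_def)
  ultimately show "a \<inter> b \<in> cylinders" using * unfolding cylinders_def by blast
qed

text \<open>Separability reduces both steps to countable operations: an open set is a countable
  union of closed balls with rational radii and centres in a countable dense set \<open>D\<close>,
  and a closed ball is an intersection of half-spaces with normals in \<open>D\<close>.\<close>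

lemma sets_borel_eq_cylinders:
  "sets (borel :: 'b::{real_inner, second_countable_topology} measure) = sigma_sets UNIV cylinders"
proof
  have "cylinder I A \<in> sets borel" if I: "finite I" and A: "\<And>u. A u \<in> sets borel" for I and A :: "'b \<Rightarrow> real set"
  proof -
    have "{w \<in> space borel. w \<bullet> u \<in> A u} \<in> sets borel" for u
      using measurable_sets[of "\<lambda>w. w \<bullet> u" borel borel "A u"] A[of u] by (simp add: vimage_def)
    then have "{w \<in> space borel. \<forall>u\<in>I. w \<bullet> u \<in> A u} \<in> sets borel"
      by (intro sets.sets_Collect_finite_All) (use I in auto)
    then show ?thesis by (simp add: cylinder_def)
  qed
  then show "sigma_sets UNIV cylinders \<subseteq> sets (borel :: 'b measure)"
    by (intro sets.sigma_sets_subset[of _ borel, simplified]) (auto simp: cylinders_def)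
next
  interpret S: sigma_algebra UNIV "sigma_sets UNIV cylinders :: 'b set set"
    by (rule sigma_algebra_sigma_sets) simp
  obtain D :: "'b set" where D: "countable D" "\<And>U. open U \<Longrightarrow> U \<noteq> {} \<Longrightarrow> \<exists>d\<in>D. d \<in> U"
    using countable_dense_setE by blast
  have dense: "v \<in> C" if "closed C" "D \<subseteq> C" for C v
    using D(2)[of "- C"] that by auto
  have D_ne: "D \<noteq> {}" using D(2)[of UNIV] by auto
  have cball: "cball y r \<in> sigma_sets UNIV cylinders" if "r \<ge> 0" for y :: 'b and r
  proof -
    have "cball y r = (\<Inter>d\<in>D. {w. w \<bullet> d \<in> {.. y \<bullet> d + r * norm d}})"
    proof (intro equalityI subsetI INT_I)
      fix w d assume "w \<in> cball y r"
      then have "(w - y) \<bullet> d \<le> r * norm d"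
        by (intro order_trans[OF norm_cauchy_schwarz] mult_right_mono) (auto simp: dist_norm norm_minus_commute)
      then show "w \<in> {w. w \<bullet> d \<in> {.. y \<bullet> d + r * norm d}}" by (simp add: inner_diff_left)
    next
      fix w assume w: "w \<in> (\<Inter>d\<in>D. {w. w \<bullet> d \<in> {.. y \<bullet> d + r * norm d}})"
      \<comment> \<open>Both sides of the inequality are continuous in \<open>d\<close>, so it
        passes from \<open>D\<close> to all vectors; the choice \<open>d = w - y\<close> then bounds
        the norm.\<close>
      have "w - y \<in> {d. (w - y) \<bullet> d \<le> r * norm d}"
      proof (rule dense)
        show "closed {d. (w - y) \<bullet> d \<le> r * norm d}"
          by (intro closed_Collect_le continuous_intros)
        show "D \<subseteq> {d. (w - y) \<bullet> d \<le> r * norm d}" using w by (auto simp: inner_diff_left)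
      qed
      then have "norm (w - y) * norm (w - y) \<le> r * norm (w - y)"
        by (simp add: power2_norm_eq_inner[symmetric] power2_eq_square)
      then have "norm (w - y) \<le> r" using that by (cases "w = y") auto
      then show "w \<in> cball y r" by (simp add: dist_norm norm_minus_commute)
    qed
    moreover have "{w. w \<bullet> d \<in> {.. y \<bullet> d + r * norm d}} \<in> cylinders" for d
      unfolding cylinders_def
      by (intro CollectI exI[of _ "{d}"] exI[of _ "\<lambda>_. {.. y \<bullet> d + r * norm d}"]) (simp add: cylinder_def)
    ultimately show ?thesis
      using D(1) D_ne by (auto intro!: S.countable_INT'')
  qed
  have "U \<in> sigma_sets UNIV cylinders" if U: "open U" for U :: "'b set"
  proof -
    define I where "I = {(d, q). d \<in> D \<and> q \<in> (\<rat> :: real set) \<and> 0 \<le> q \<and> cball d q \<subseteq> U}"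
    have "countable I"
      by (rule countable_subset[of _ "D \<times> \<rat>"]) (auto simp: I_def D(1) countable_rat)
    have "U = (\<Union>(d, q)\<in>I. cball d q)"
    proof (intro equalityI subsetI)
      fix w assume "w \<in> U"
      then obtain e where e: "e > 0" "ball w e \<subseteq> U" using U openE by blast
      obtain q where q: "q \<in> \<rat>" "0 < q" "q < e / 2"
        using Rats_dense_in_real[of 0 "e / 2"] e by auto
      obtain d where d: "d \<in> D" "d \<in> ball w q" using D(2)[of "ball w q"] q by auto
      have "cball d q \<subseteq> ball w e"
      proof
        fix z assume "z \<in> cball d q"
        then show "z \<in> ball w e" using d q dist_triangle[of w z d] by auto
      qed
      then have "(d, q) \<in> I" using d q e by (auto simp: I_def)
      moreover have "w \<in> cball d q" using d by (auto simp: dist_commute)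
      ultimately show "w \<in> (\<Union>(d, q)\<in>I. cball d q)" by blast
    qed (auto simp: I_def)
    also have "\<dots> \<in> sigma_sets UNIV cylinders"
      using \<open>countable I\<close> cball by (intro S.countable_UN') (auto simp: I_def)
    finally show ?thesis .
  qed
  then have "sigma_sets UNIV {U :: 'b set. open U} \<subseteq> sigma_sets UNIV cylinders"
    by (intro S.sigma_sets_subset) auto
  then show "sets (borel :: 'b measure) \<subseteq> sigma_sets UNIV cylinders"
    by (simp add: borel_def)
qed

text \<open>Induction on the directions of a cylinder: \<open>char_functional_localize\<close>
  inserts one more indicator into the characteristic functional, with the previous indicators as the
  weight. The claim is kept for all \<open>v\<close>, since the next step consumes the functional in
  every direction; only at the end does \<open>v = 0\<close> give the measure of the
  cylinder.\<close>

theorem Cramer_Wold_uniqueness: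
  fixes Q1 Q2 :: "'b::{real_inner, second_countable_topology} measure"
  assumes Q: "prob_space Q1" "prob_space Q2"
    and sets: "sets Q1 = sets borel" "sets Q2 = sets borel"
    and proj: "\<And>v. distr Q1 borel (\<lambda>w. w \<bullet> v) = distr Q2 borel (\<lambda>w. w \<bullet> v)"
  shows "Q1 = Q2"
proof -
  note [measurable_cong, simp] = sets
  interpret Q1: prob_space Q1 by fact
  interpret Q2: prob_space Q2 by fact
  have char_eq: "(CLINT w|Q1. (\<Prod>u\<in>I. indicat_real (A u) (w \<bullet> u)) *\<^sub>R iexp (w \<bullet> v))
      = (CLINT w|Q2. (\<Prod>u\<in>I. indicator (A u) (w \<bullet> u)) *\<^sub>R iexp (w \<bullet> v))"
    if "finite I" and [measurable]: "\<And>u. A u \<in> sets borel" for I v and A :: "'b \<Rightarrow> real set"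
    using \<open>finite I\<close>
  proof (induction I arbitrary: v)
    case empty
    have "(CLINT s|distr Q1 borel (\<lambda>w. w \<bullet> v). iexp s) = (CLINT s|distr Q2 borel (\<lambda>w. w \<bullet> v). iexp s)"
      by (simp add: proj)
    then show ?case by (simp add: integral_distr)
  next
    case (insert u I)
    let ?G = "\<lambda>w. \<Prod>u\<in>I. indicat_real (A u) (w \<bullet> u)"
    have "(CLINT w|Q1. (?G w * indicator (A u) (w \<bullet> u)) *\<^sub>R iexp (w \<bullet> v))
        = (CLINT w|Q2. (?G w * indicator (A u) (w \<bullet> u)) *\<^sub>R iexp (w \<bullet> v))"
      by (rule char_functional_localize[OF Q sets, where b = 1])
         (auto intro!: prod_nonneg prod_le_1 insert.IH)
    then show ?case using insert.hyps by (simp add: mult.commute)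
  qed
  show ?thesis
  proof (rule measure_eqI_generator_eq[OF Int_stable_cylinders, where A = "\<lambda>_. UNIV" and \<Omega> = UNIV])
    fix X :: "'b set" assume "X \<in> cylinders"
    then obtain I A where IA: "finite I" "\<And>u. A u \<in> sets borel" and X: "X = cylinder I A"
      unfolding cylinders_def by blast
    have Xs: "X \<in> sets borel"
      using \<open>X \<in> cylinders\<close> unfolding sets_borel_eq_cylinders by (rule sigma_sets.Basic)
    have ind: "(\<Prod>u\<in>I. indicat_real (A u) (w \<bullet> u)) = indicator X w" for w
      unfolding X cylinder_def using IA(1) by (auto simp: indicator_def prod_zero_iff intro!: prod.neutral)
    have char_eq0: "(CLINT w|Q1. (\<Prod>u\<in>I. indicat_real (A u) (w \<bullet> u)) *\<^sub>R iexp (w \<bullet> 0))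
      = (CLINT w|Q2. (\<Prod>u\<in>I. indicator (A u) (w \<bullet> u)) *\<^sub>R iexp (w \<bullet> 0))"
      by (rule char_eq[OF IA])
    have "(CLINT w|Q1. complex_of_real (indicator X w)) = (CLINT w|Q2. complex_of_real (indicator X w))"
      using char_eq0 by (simp add: ind scaleR_conv_of_real)
    then have "measure Q1 X = measure Q2 X"
      using Xs sets by (simp add: sets_eq_imp_space_eq[OF sets(1)] sets_eq_imp_space_eq[OF sets(2)])
    then show "emeasure Q1 X = emeasure Q2 X"
      by (simp add: Q1.emeasure_eq_measure Q2.emeasure_eq_measure)
  next
    have "(UNIV :: 'b set) = cylinder {} (\<lambda>_. {})" by (simp add: cylinder_def)
    then show "range (\<lambda>_::nat. UNIV) \<subseteq> (cylinders :: 'b set set)"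
      unfolding cylinders_def by blast
  qed (simp_all add: sets_borel_eq_cylinders[symmetric])
qed

subsection \<open>Gaussian laws with finite rank covariance\<close>

text \<open>The variance also decides between the two shapes: it is 0 for a point mass and positive
  otherwise. In the second case positivity of \<open>\<sigma>\<close> makes it recoverable from its
  square.\<close>

lemma real_gaussian_law_unique:
  assumes Q: "real_gaussian_law Q" "real_gaussian_law Q'"
    and mean: "(\<integral>t. t \<partial>Q) = 0" "(\<integral>t. t \<partial>Q') = 0"
    and var: "(\<integral>t. t\<^sup>2 \<partial>Q) = (\<integral>t. t\<^sup>2 \<partial>Q')"
  shows "Q = Q'"
proof -
  have cases: "(R = return borel 0 \<and> (\<integral>t. t\<^sup>2 \<partial>R) = 0) \<or>
      (\<exists>\<sigma>>0. R = density lborel (normal_density 0 \<sigma>) \<and> (\<integral>t. t\<^sup>2 \<partial>R) = \<sigma>\<^sup>2)"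
    if "real_gaussian_law R" "(\<integral>t. t \<partial>R) = 0" for R
    using that(1) unfolding real_gaussian_law_def
  proof (elim disjE exE conjE)
    fix \<mu> assume R: "R = return borel \<mu>"
    then have "\<mu> = 0" using that(2) by (simp add: integral_return)
    then show ?thesis using R by (simp add: integral_return)
  next
    fix \<mu> \<sigma> :: real assume \<sigma>: "\<sigma> > 0" and R: "R = density lborel (\<lambda>t. ennreal (normal_density \<mu> \<sigma> t))"
    have "(\<integral>t. t \<partial>R) = \<mu>"
      unfolding R using integral_normal_moment_nz_1[OF \<sigma>, of \<mu>]
      by (subst integral_density) (auto simp: normal_density_nonneg)
    then have "\<mu> = 0" using that(2) by simp
    moreover have "(\<integral>t. t\<^sup>2 \<partial>R) = \<sigma>\<^sup>2"
      unfolding R \<open>\<mu> = 0\<close> using integral_normal_moment_even[OF \<sigma>, of 0 1]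
      by (subst integral_density) (auto simp: normal_density_nonneg eval_nat_numeral)
    ultimately show ?thesis using R \<sigma> by blast
  qed
  show ?thesis
    using cases[OF Q(1) mean(1)] cases[OF Q(2) mean(2)] var by (auto simp: power2_eq_iff)
qed

text \<open>Every projection is a centred normal law with variance \<open>S v \<bullet> v\<close>,
  so the projections agree, and they determine the law.\<close>

lemma gaussian_law_unique:
  assumes Q: "gaussian_law Q 0 S" and Q': "gaussian_law Q' 0 S"
  shows "Q = Q'"
proof (rule Cramer_Wold_uniqueness)
  fix v
  have [measurable]: "(\<lambda>w. w \<bullet> v) \<in> borel_measurable Q" "(\<lambda>w. w \<bullet> v) \<in> borel_measurable Q'"
    using Q Q' by (auto simp: gaussian_law_def cong: measurable_cong_sets)
  show "distr Q borel (\<lambda>w. w \<bullet> v) = distr Q' borel (\<lambda>w. w \<bullet> v)"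
  proof (rule real_gaussian_law_unique)
    show "(\<integral>t. t\<^sup>2 \<partial>distr Q borel (\<lambda>w. w \<bullet> v)) = (\<integral>t. t\<^sup>2 \<partial>distr Q' borel (\<lambda>w. w \<bullet> v))"
      using Q Q' by (simp add: integral_distr gaussian_law_def power2_eq_square)
  qed (use Q Q' in \<open>simp_all add: integral_distr gaussian_law_def\<close>)
qed (use Q Q' in \<open>auto simp: gaussian_law_def\<close>)

text \<open>The space on which the Gaussian laws are realised. Its index set will depend only on the
  group sizes; the sample enters through the coefficients of a linear combination, a separation that
  later gives joint measurability.\<close>

abbreviation iid_std_normal :: "'i set \<Rightarrow> ('i \<Rightarrow> real) measure" where
  "iid_std_normal I \<equiv> PiM I (\<lambda>_. std_normal_distribution)"

lemma prob_space_iid_std_normal: "prob_space (iid_std_normal I)"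
  by (intro prob_space_PiM) (auto intro: prob_space_normal_density)

lemma
  assumes s: "s \<in> I"
  shows distributed_iid_std_normal: "distributed (iid_std_normal I) lborel (\<lambda>z. z s) std_normal_density"
    and integrable_iid_std_normal: "integrable (iid_std_normal I) (\<lambda>z. z s)"
    and expectation_iid_std_normal: "(\<integral>z. z s \<partial>iid_std_normal I) = 0"
    and integrable_iid_std_normal_sq: "integrable (iid_std_normal I) (\<lambda>z. z s * z s)"
    and expectation_iid_std_normal_sq: "(\<integral>z. z s * z s \<partial>iid_std_normal I) = 1"
proof -
  have comp: "distr (iid_std_normal I) std_normal_distribution (\<lambda>z. z s) = std_normal_distribution"
    using s by (intro distr_PiM_component) (auto intro: prob_space_normal_density)
  have m [measurable]: "(\<lambda>z. z s) \<in> borel_measurable (iid_std_normal I)"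
    using measurable_component_singleton[OF s, of "\<lambda>_. std_normal_distribution"] by simp
  \<comment> \<open>\<open>distr\<close> uses only the measurable sets of its target, so the target
    \<open>std_normal_distribution\<close> may be replaced by \<open>lborel\<close>.\<close>
  have "distr (iid_std_normal I) lborel (\<lambda>z. z s)
      = distr (iid_std_normal I) std_normal_distribution (\<lambda>z. z s)"
    by (intro distr_cong) auto
  then show D: "distributed (iid_std_normal I) lborel (\<lambda>z. z s) std_normal_density"
    unfolding distributed_def using comp by simp
  interpret prob_space "iid_std_normal I" by (rule prob_space_iid_std_normal)
  show "(\<integral>z. z s \<partial>iid_std_normal I) = 0"
    by (rule standard_normal_distributed_expectation[OF D])
  then show "(\<integral>z. z s * z s \<partial>iid_std_normal I) = 1"
    using standard_normal_distributed_variance[OF D] by (simp add: power2_eq_square)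
  show "integrable (iid_std_normal I) (\<lambda>z. z s)"
    using integrable_std_normal_moment[of 1] distributed_integrable[OF D, of "\<lambda>x. x"] by simp
  show "integrable (iid_std_normal I) (\<lambda>z. z s * z s)"
    using integrable_std_normal_moment[of 2] distributed_integrable[OF D, of "\<lambda>x. x * x"]
    by (simp add: power2_eq_square)
qed

lemma indep_vars_iid_std_normal:
  assumes "I \<noteq> {}"
  shows "prob_space.indep_vars (iid_std_normal I) (\<lambda>_. borel) (\<lambda>s z. z s) I"
proof -
  interpret prob_space "iid_std_normal I" by (rule prob_space_iid_std_normal)
  have m: "(\<lambda>z. z s) \<in> measurable (iid_std_normal I) std_normal_distribution" if "s \<in> I" for s
    using that by measurable
  have "indep_vars (\<lambda>_. std_normal_distribution) (\<lambda>s z. z s) I"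
  proof (subst indep_vars_iff_distr_eq_PiM'[OF assms m])
    have "distr (iid_std_normal I) (iid_std_normal I) (\<lambda>x. \<lambda>i\<in>I. x i)
        = distr (iid_std_normal I) (iid_std_normal I) (\<lambda>x. x)"
      by (intro distr_cong) (auto simp: space_PiM)
    also have "\<dots> = iid_std_normal I" by simp
    also have "\<dots> = (\<Pi>\<^sub>M i\<in>I. distr (iid_std_normal I) std_normal_distribution (\<lambda>z. z i))"
      by (intro PiM_cong refl distr_PiM_component[symmetric]) (auto intro: prob_space_normal_density)
    finally show "distr (iid_std_normal I) (iid_std_normal I) (\<lambda>x. \<lambda>i\<in>I. x i)
        = (\<Pi>\<^sub>M i\<in>I. distr (iid_std_normal I) std_normal_distribution (\<lambda>z. z i))" .
  qed
  then show ?thesis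
    unfolding indep_vars_def by simp
qed

lemma
  assumes s: "s \<in> I" "t \<in> I"
  shows integrable_iid_std_normal_mult: "integrable (iid_std_normal I) (\<lambda>z. z s * z t)"
    and expectation_iid_std_normal_mult: "(\<integral>z. z s * z t \<partial>iid_std_normal I) = (if s = t then 1 else 0)"
proof -
  interpret prob_space "iid_std_normal I" by (rule prob_space_iid_std_normal)
  have "integrable (iid_std_normal I) (\<lambda>z. z s * z t) \<and> (\<integral>z. z s * z t \<partial>iid_std_normal I) = 0" if "s \<noteq> t"
  proof -
    have indep: "indep_var borel (\<lambda>z. z s) borel (\<lambda>z. z t)"
    proof -
      have "indep_var (PiM {s} (\<lambda>_. borel)) (\<lambda>z. \<lambda>i\<in>{s}. z i) (PiM {t} (\<lambda>_. borel)) (\<lambda>z. \<lambda>i\<in>{t}. z i)"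
        using s that by (intro indep_var_restrict[OF indep_vars_iid_std_normal]) auto
      from indep_var_compose[OF this, of "\<lambda>f. f s" borel "\<lambda>f. f t" borel]
      show ?thesis by (simp add: comp_def)
    qed
    show ?thesis
      using indep_var_lebesgue_integral[OF indep] indep_var_integrable[OF indep]
        integrable_iid_std_normal[OF s(1)] integrable_iid_std_normal[OF s(2)]
        expectation_iid_std_normal[OF s(1)] by auto
  qed
  then show "integrable (iid_std_normal I) (\<lambda>z. z s * z t)"
    and "(\<integral>z. z s * z t \<partial>iid_std_normal I) = (if s = t then 1 else 0)"
    using integrable_iid_std_normal_sq[OF s(1)] expectation_iid_std_normal_sq[OF s(1)] by (cases "s = t"; simp)+
qed

text \<open>The second moment matrix is the identity, so only diagonal coefficients survive. With
  \<open>c s t = (f s \<bullet> u) * (f t \<bullet> v)\<close> this yields the covariance, with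
  \<open>c s t = f s \<bullet> f t\<close> the trace.\<close>

lemma expectation_iid_std_normal_quadratic:
  assumes "finite I"
  shows "integrable (iid_std_normal I) (\<lambda>z. \<Sum>s\<in>I. \<Sum>t\<in>I. z s * z t * c s t)"
    and "(\<integral>z. (\<Sum>s\<in>I. \<Sum>t\<in>I. z s * z t * c s t) \<partial>iid_std_normal I) = (\<Sum>s\<in>I. c s s)"
proof -
  show "integrable (iid_std_normal I) (\<lambda>z. \<Sum>s\<in>I. \<Sum>t\<in>I. z s * z t * c s t)"
    by (intro Bochner_Integration.integrable_sum integrable_mult_left integrable_iid_std_normal_mult)
  have "(\<integral>z. (\<Sum>s\<in>I. \<Sum>t\<in>I. z s * z t * c s t) \<partial>iid_std_normal I)
      = (\<Sum>s\<in>I. \<Sum>t\<in>I. (\<integral>z. z s * z t \<partial>iid_std_normal I) * c s t)"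
    by (simp add: Bochner_Integration.integral_sum Bochner_Integration.integrable_sum
        integrable_mult_left integrable_iid_std_normal_mult)
  also have "\<dots> = (\<Sum>s\<in>I. \<Sum>t\<in>I. if s = t then c s t else 0)"
    by (intro sum.cong refl) (simp add: expectation_iid_std_normal_mult)
  also have "\<dots> = (\<Sum>s\<in>I. c s s)"
    using assms by (simp add: sum.delta')
  finally show "(\<integral>z. (\<Sum>s\<in>I. \<Sum>t\<in>I. z s * z t * c s t) \<partial>iid_std_normal I) = (\<Sum>s\<in>I. c s s)" .
qed

text \<open>Vanishing coefficients are removed, because scaling by 0 leaves the family of normal
  densities. If none remains, the law is the point mass at 0, the degenerate case of
  \<open>real_gaussian_law\<close>; otherwise the theorem on sums of independent normal variables
  applies.\<close>

lemma real_gaussian_law_std_normal_combination: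
  fixes c :: "'i \<Rightarrow> real"
  assumes I: "finite I"
  shows "real_gaussian_law (distr (iid_std_normal I) borel (\<lambda>z. \<Sum>s\<in>I. z s * c s))"
proof -
  interpret prob_space "iid_std_normal I" by (rule prob_space_iid_std_normal)
  let ?J = "{s\<in>I. c s \<noteq> 0}"
  have eq: "(\<Sum>s\<in>I. z s * c s) = (\<Sum>s\<in>?J. z s * c s)" for z
    using I by (intro sum.mono_neutral_right) auto
  show ?thesis
  proof (cases "?J = {}")
    case True
    then have "distr (iid_std_normal I) borel (\<lambda>z. \<Sum>s\<in>I. z s * c s) = return borel 0"
      unfolding eq True by (simp add: distr_const)
    then show ?thesis unfolding real_gaussian_law_def by blast
  next
    case False
    have "indep_vars (\<lambda>_. borel) (\<lambda>s z. z s) ?J"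
      using False by (intro indep_vars_subset[OF indep_vars_iid_std_normal]) auto
    then have indep: "indep_vars (\<lambda>_. borel) (\<lambda>s z. z s * c s) ?J"
      by (rule indep_vars_compose2) simp
    have "distributed (iid_std_normal I) lborel (\<lambda>z. \<Sum>s\<in>?J. z s * c s)
        (normal_density (\<Sum>s\<in>?J. 0) (sqrt (\<Sum>s\<in>?J. \<bar>c s\<bar>\<^sup>2)))"
    proof (rule sum_indep_normal[OF _ False indep])
      fix s assume s: "s \<in> ?J"
      then have "distributed (iid_std_normal I) lborel (\<lambda>z. z s) (normal_density 0 1)"
        by (simp add: distributed_iid_std_normal)
      from normal_density_affine[OF this, of "c s" 0]
      show "distributed (iid_std_normal I) lborel (\<lambda>z. z s * c s) (normal_density 0 \<bar>c s\<bar>)"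
        using s by (simp add: mult.commute)
    qed (use I in auto)
    then have "distr (iid_std_normal I) lborel (\<lambda>z. \<Sum>s\<in>?J. z s * c s)
        = density lborel (normal_density 0 (sqrt (\<Sum>s\<in>?J. \<bar>c s\<bar>\<^sup>2)))"
      by (simp add: distributed_def)
    moreover have "distr (iid_std_normal I) lborel (\<lambda>z. \<Sum>s\<in>?J. z s * c s)
        = distr (iid_std_normal I) borel (\<lambda>z. \<Sum>s\<in>?J. z s * c s)"
      by (intro distr_cong) auto
    moreover have "sqrt (\<Sum>s\<in>?J. \<bar>c s\<bar>\<^sup>2) > 0"
      using False I by (auto intro!: sum_pos)
    ultimately show ?thesis
      unfolding eq real_gaussian_law_def by metis
  qed
qed

text \<open>A decomposition of the form of \<open>S\<close> into rank one terms takes the place of a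
  square root of \<open>S\<close>: one standard normal coordinate drives each term.\<close>

lemma gaussian_law_std_normal_combination:
  fixes f :: "'i \<Rightarrow> 'b::{real_inner, banach, second_countable_topology}"
  assumes I: "finite I" and S: "\<And>u v. S u \<bullet> v = (\<Sum>s\<in>I. (f s \<bullet> u) * (f s \<bullet> v))"
  shows "gaussian_law (distr (iid_std_normal I) borel (\<lambda>z. \<Sum>s\<in>I. z s *\<^sub>R f s)) 0 S"
proof -
  interpret prob_space "iid_std_normal I" by (rule prob_space_iid_std_normal)
  let ?F = "\<lambda>z. \<Sum>s\<in>I. z s *\<^sub>R f s"
  have comp: "(\<lambda>z. z s) \<in> borel_measurable (iid_std_normal I)" if "s \<in> I" for s
    using integrable_iid_std_normal[OF that] by auto
  then have F [measurable]: "?F \<in> borel_measurable (iid_std_normal I)"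
    by (intro borel_measurable_sum borel_measurable_scaleR) auto
  have inner: "?F z \<bullet> v = (\<Sum>s\<in>I. z s * (f s \<bullet> v))" for z v
    by (simp add: inner_sum_left)
  show ?thesis
    unfolding gaussian_law_def
  proof (intro conjI allI)
    show "prob_space (distr (iid_std_normal I) borel ?F)" by (rule prob_space_distr) simp
    show "real_gaussian_law (distr (distr (iid_std_normal I) borel ?F) borel (\<lambda>w. w \<bullet> v))" for v
      using real_gaussian_law_std_normal_combination[OF I, of "\<lambda>s. f s \<bullet> v"]
      by (simp add: distr_distr comp_def inner)
    show "(\<integral>w. w \<bullet> v \<partial>distr (iid_std_normal I) borel ?F) = 0 \<bullet> v" for v
      by (simp add: integral_distr inner Bochner_Integration.integral_sum integrable_mult_left
          integrable_iid_std_normal expectation_iid_std_normal)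
    show "(\<integral>w. (w - 0) \<bullet> u * ((w - 0) \<bullet> v) \<partial>distr (iid_std_normal I) borel ?F) = S u \<bullet> v" for u v
    proof -
      have "(?F z \<bullet> u) * (?F z \<bullet> v) = (\<Sum>s\<in>I. \<Sum>t\<in>I. z s * z t * ((f s \<bullet> u) * (f t \<bullet> v)))" for z
        unfolding inner by (simp add: sum_product mult_ac)
      then show ?thesis
        using expectation_iid_std_normal_quadratic(2)[OF I, of "\<lambda>s t. (f s \<bullet> u) * (f t \<bullet> v)"]
        by (simp add: integral_distr S)
    qed
  qed simp
qed

text \<open>The value is the trace of the covariance operator, the quantity that Markov's inequality
  for the squared norm needs.\<close>

lemma std_normal_combination_second_moment:
  fixes f :: "'i \<Rightarrow> 'b::{real_inner}"
  assumes I: "finite I"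
  shows "integrable (iid_std_normal I) (\<lambda>z. (norm (\<Sum>s\<in>I. z s *\<^sub>R f s))\<^sup>2)"
    and "(\<integral>z. (norm (\<Sum>s\<in>I. z s *\<^sub>R f s))\<^sup>2 \<partial>iid_std_normal I) = (\<Sum>s\<in>I. (norm (f s))\<^sup>2)"
proof -
  have "(norm (\<Sum>s\<in>I. z s *\<^sub>R f s))\<^sup>2 = (\<Sum>s\<in>I. \<Sum>t\<in>I. z s * z t * (f s \<bullet> f t))" for z
    unfolding power2_norm_eq_inner inner_sum_left unfolding inner_sum_right by (simp add: mult_ac)
  then show "integrable (iid_std_normal I) (\<lambda>z. (norm (\<Sum>s\<in>I. z s *\<^sub>R f s))\<^sup>2)"
    and "(\<integral>z. (norm (\<Sum>s\<in>I. z s *\<^sub>R f s))\<^sup>2 \<partial>iid_std_normal I) = (\<Sum>s\<in>I. (norm (f s))\<^sup>2)"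
    using expectation_iid_std_normal_quadratic[OF I, of "\<lambda>s t. f s \<bullet> f t"]
    by (simp_all add: power2_norm_eq_inner)
qed

subsection \<open>The estimated covariance operator\<close>

definition group_mean_sign ::
    "('k \<Rightarrow> nat) \<Rightarrow> ('k \<Rightarrow> nat \<Rightarrow> 'a::real_normed_vector) \<Rightarrow> 'k \<Rightarrow> 'a \<Rightarrow> 'a" where
  "group_mean_sign N x k y = (1 / real (N k)) *\<^sub>R (\<Sum>p<N k. sgn (x k p - y))"

definition pair_mean_sign ::
    "('k \<Rightarrow> nat) \<Rightarrow> ('k \<Rightarrow> nat \<Rightarrow> 'a::real_normed_vector) \<Rightarrow> 'k \<Rightarrow> 'k \<Rightarrow> 'a" where
  "pair_mean_sign N x k l = (1 / (real (N k) * real (N l))) *\<^sub>R (\<Sum>p<N k. \<Sum>m<N l. sgn (x k p - x l m))"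

text \<open>The normalisation of \<^const>\<open>C_op\<close> mixes the factors \<open>n - 1\<close> and \<open>n\<close>, so that it is the sample
  covariance plus \<open>1 / (n - 1)\<close> times the product of the means; the index \<open>m = N l\<close> stands for
  this extra term.\<close>
definition cov_factor ::
    "('k \<Rightarrow> nat) \<Rightarrow> ('k \<Rightarrow> nat \<Rightarrow> 'a::real_normed_vector) \<Rightarrow> 'k \<Rightarrow> nat \<Rightarrow> 'k \<Rightarrow> 'a" where
  "cov_factor N x l m k =
     (if m < N l then group_mean_sign N x k (x l m) - pair_mean_sign N x k l
      else pair_mean_sign N x k l)"

lemma sum_group_mean_sign:
  assumes "N l > 0"
  shows "(\<Sum>m<N l. group_mean_sign N x k (x l m)) = real (N l) *\<^sub>R pair_mean_sign N x k l"
  using assms unfolding group_mean_sign_def pair_mean_sign_def scaleR_sum_right[symmetric]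
  by (subst sum.swap) simp

text \<open>For all \<open>i\<close> and \<open>j\<close> the same vectors indexed by
  \<open>(l, m)\<close> occur, each depending on one further group only; this common factorisation
  lets the blocks be assembled into squares. Algebraically, centring subtracts
  \<open>n * a * b\<close> from the sum of products, while \<open>C_op\<close> subtracts
  \<open>(n - 1) * a * b\<close> before the division; the additional term \<open>a * b\<close>
  restores the difference.\<close>

lemma C_op_form:
  fixes x :: "'k::finite \<Rightarrow> nat \<Rightarrow> 'a::real_inner"
  assumes N: "N l \<ge> 2"
  shows "C_op N x i j l u \<bullet> v = (1 / (real (N l) - 1)) *
     (\<Sum>m\<le>N l. (cov_factor N x l m i \<bullet> u) * (cov_factor N x l m j \<bullet> v))"
proof -
  let ?n = "real (N l)"
  define \<alpha> where "\<alpha> m = u \<bullet> group_mean_sign N x i (x l m)" for m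
  define \<beta> where "\<beta> m = group_mean_sign N x j (x l m) \<bullet> v" for m
  define a where "a = u \<bullet> pair_mean_sign N x i l"
  define b where "b = pair_mean_sign N x j l \<bullet> v"
  have n: "?n - 1 > 0" using N by simp
  have \<alpha>: "(\<Sum>m<N l. \<alpha> m) = ?n * a" and \<beta>: "(\<Sum>m<N l. \<beta> m) = ?n * b"
    using N sum_group_mean_sign[of N l x] by (simp_all add: \<alpha>_def \<beta>_def a_def b_def inner_sum_left[symmetric] inner_sum_right[symmetric])
  have "C_op N x i j l u \<bullet> v = (1 / (?n - 1)) * (\<Sum>m<N l. \<alpha> m * \<beta> m) - a * b"
    unfolding C_op_def group_mean_sign_def[symmetric] pair_mean_sign_def[symmetric]
    by (simp add: blinfun.diff_left blinfun.scaleR_left blinfun.sum_left tensor_apply inner_diff_left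
        inner_sum_left \<alpha>_def \<beta>_def a_def b_def)
  moreover have "(\<Sum>m<N l. (\<alpha> m - a) * (\<beta> m - b)) = (\<Sum>m<N l. \<alpha> m * \<beta> m) - ?n * a * b"
  proof -
    have "(\<Sum>m<N l. (\<alpha> m - a) * (\<beta> m - b))
        = (\<Sum>m<N l. \<alpha> m * \<beta> m) - (\<Sum>m<N l. \<alpha> m) * b - a * (\<Sum>m<N l. \<beta> m) + ?n * (a * b)"
      by (simp add: algebra_simps sum.distrib sum_subtractf sum_distrib_left)
    then show ?thesis by (simp add: \<alpha> \<beta>)
  qed
  moreover have "(\<Sum>m\<le>N l. (cov_factor N x l m i \<bullet> u) * (cov_factor N x l m j \<bullet> v))
      = (\<Sum>m<N l. (\<alpha> m - a) * (\<beta> m - b)) + a * b"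
    by (simp add: lessThan_Suc_atMost[symmetric] cov_factor_def \<alpha>_def \<beta>_def a_def b_def inner_diff_left inner_diff_right inner_commute[of _ u])
  ultimately show ?thesis using n by (simp add: field_simps)
qed

text \<open>For \<open>m < N l\<close> this is, up to normalisation, the estimated and centred first
  order contribution of observation \<open>m\<close> of group \<open>l\<close> to the rank vector:
  the observation is subtracted in the mean rank of each group \<open>k\<close>, and occurs with the
  opposite sign, averaged over all groups, in the mean rank of its own group. For
  \<open>k = l\<close> the two within-group terms cancel.\<close>

definition sigma_factor ::
    "('k::finite \<Rightarrow> nat) \<Rightarrow> ('k \<Rightarrow> nat \<Rightarrow> 'a::real_inner) \<Rightarrow> 'k \<times> nat \<Rightarrow> 'a ^ 'k" where
  "sigma_factor N x = (\<lambda>(l, m). \<chi> k.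
     sqrt (real (N l) / real (total_size N) / (real (N l) - 1)) *\<^sub>R
       (sqrt (real (N k) / real (total_size N)) *\<^sub>R cov_factor N x l m k
        - (if k = l then (1 / sqrt (real (N l) / real (total_size N))) *\<^sub>R
             (\<Sum>i\<in>UNIV. (real (N i) / real (total_size N)) *\<^sub>R cov_factor N x l m i) else 0)))"

definition factor_index :: "('k::finite \<Rightarrow> nat) \<Rightarrow> ('k \<times> nat) set" where
  "factor_index N = (SIGMA l:UNIV. {..N l})"

lemma finite_factor_index [simp]: "finite (factor_index N)"
  by (simp add: factor_index_def)

text \<open>Pulls product weights through a sum of rank one terms; in this way each of the four sums
  in \<open>sigma_block\<close> becomes a sum of products of linear forms.\<close>

lemma sum_bilinear_rank_one:
  fixes c :: "'c::comm_semiring_0"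
  shows "(\<Sum>i\<in>I. \<Sum>j\<in>J. \<alpha> i * \<beta> j * (c * (\<Sum>m\<in>R. f m i * g m j)))
    = c * (\<Sum>m\<in>R. (\<Sum>i\<in>I. \<alpha> i * f m i) * (\<Sum>j\<in>J. \<beta> j * g m j))"
proof -
  have "(\<Sum>i\<in>I. \<Sum>j\<in>J. \<alpha> i * \<beta> j * (c * (\<Sum>m\<in>R. f m i * g m j)))
     = (\<Sum>i\<in>I. \<Sum>j\<in>J. \<Sum>m\<in>R. c * ((\<alpha> i * f m i) * (\<beta> j * g m j)))"
    by (simp add: sum_distrib_left mult_ac)
  also have "\<dots> = (\<Sum>i\<in>I. \<Sum>m\<in>R. \<Sum>j\<in>J. c * ((\<alpha> i * f m i) * (\<beta> j * g m j)))"
    by (intro sum.cong refl sum.swap)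
  also have "\<dots> = (\<Sum>m\<in>R. \<Sum>i\<in>I. \<Sum>j\<in>J. c * ((\<alpha> i * f m i) * (\<beta> j * g m j)))"
    by (rule sum.swap)
  also have "\<dots> = c * (\<Sum>m\<in>R. (\<Sum>i\<in>I. \<alpha> i * f m i) * (\<Sum>j\<in>J. \<beta> j * g m j))"
    unfolding sum_product by (simp add: sum_distrib_left)
  finally show ?thesis .
qed

text \<open>Completing the square: block \<open>(l, l)\<close> of the last sum in \<^const>\<open>sigma_block\<close>, the two mixed
  sums and the summand \<open>l\<close> of the first sum combine to the square of one linear form per \<open>(l, m)\<close>.\<close>
lemma Sigma_op_rank_one_sum:
  fixes x :: "'k::finite \<Rightarrow> nat \<Rightarrow> 'a::real_inner"
  assumes N: "\<And>k. N k \<ge> 2"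
  shows "Sigma_op N x w \<bullet> v
    = (\<Sum>s\<in>factor_index N. (sigma_factor N x s \<bullet> w) * (sigma_factor N x s \<bullet> v))"
proof -
  define n where "n = real (total_size N)"
  define p where "p k = real (N k) / n" for k
  define c where "c l = 1 / (real (N l) - 1)" for l
  define b where "b = cov_factor N x"
  define B where "B l i u j v = c l * (\<Sum>m\<le>N l. (b l m i \<bullet> u) * (b l m j \<bullet> v))" for l i u j v
  \<comment> \<open>\<open>A\<close> and \<open>D\<close> are the two linear forms that make up the
    inner product with \<open>sigma_factor\<close>: \<open>A\<close> collects all blocks of the
    argument, while \<open>D\<close> reads only block \<open>l\<close>, through the average over the
    groups.\<close>
  define A where "A l m w = (\<Sum>k\<in>UNIV. sqrt (p k) * (b l m k \<bullet> (w $ k)))" for l m and w :: "'a ^ 'k"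
  define D where "D l m w = (\<Sum>i\<in>UNIV. p i * (b l m i \<bullet> (w $ l)))" for l m and w :: "'a ^ 'k"
  have n: "n > 0"
    unfolding n_def total_size_def using N by (auto intro!: sum_pos intro: less_le_trans[of 0 2])
  have p: "p k > 0" for k using n N[of k] by (simp add: p_def)
  have c: "c k > 0" for k using N[of k] by (simp add: c_def)
  have C: "C_op N x i j l u \<bullet> v = B l i u j v" for i j l u v
    using C_op_form[OF N] by (simp add: B_def c_def b_def)
  have sq: "sqrt (real (N k1) * real (N k2)) / n = sqrt (p k1) * sqrt (p k2)" for k1 k2
    using n by (simp add: p_def real_sqrt_mult real_sqrt_divide)
  have block: "sigma_block N x k1 k2 u \<bullet> v
      = sqrt (p k1) * sqrt (p k2) * (\<Sum>l\<in>UNIV. p l * (B l k1 u k2 v - B k1 l u k2 v - B k2 k1 u l v))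
        + (if k1 = k2 then \<Sum>l1\<in>UNIV. \<Sum>l2\<in>UNIV. p l1 * p l2 * B k1 l1 u l2 v else 0)" for k1 k2 u v
    unfolding sigma_block_def n_def[symmetric] sq
    by (simp add: blinfun.diff_left blinfun.add_left blinfun.scaleR_left blinfun.sum_left inner_diff_left
        inner_add_left inner_sum_left C) (simp add: p_def power2_eq_square)
  have T1: "(\<Sum>k1\<in>UNIV. \<Sum>k2\<in>UNIV. sqrt (p k1) * sqrt (p k2) * (\<Sum>l\<in>UNIV. p l * B l k1 (w $ k1) k2 (v $ k2)))
      = (\<Sum>l\<in>UNIV. c l * (\<Sum>m\<le>N l. p l * (A l m w * A l m v)))"
  proof -
    have "(\<Sum>k1\<in>UNIV. \<Sum>k2\<in>UNIV. sqrt (p k1) * sqrt (p k2) * (\<Sum>l\<in>UNIV. p l * B l k1 (w $ k1) k2 (v $ k2)))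
       = (\<Sum>k1\<in>UNIV. \<Sum>k2\<in>UNIV. \<Sum>l\<in>UNIV. p l * (sqrt (p k1) * sqrt (p k2) * B l k1 (w $ k1) k2 (v $ k2)))"
      by (simp add: sum_distrib_left mult_ac)
    also have "\<dots> = (\<Sum>k1\<in>UNIV. \<Sum>l\<in>UNIV. \<Sum>k2\<in>UNIV. p l * (sqrt (p k1) * sqrt (p k2) * B l k1 (w $ k1) k2 (v $ k2)))"
      by (intro sum.cong refl sum.swap)
    also have "\<dots> = (\<Sum>l\<in>UNIV. \<Sum>k1\<in>UNIV. \<Sum>k2\<in>UNIV. p l * (sqrt (p k1) * sqrt (p k2) * B l k1 (w $ k1) k2 (v $ k2)))"
      by (rule sum.swap)
    also have "\<dots> = (\<Sum>l\<in>UNIV. p l * (\<Sum>k1\<in>UNIV. \<Sum>k2\<in>UNIV. sqrt (p k1) * sqrt (p k2) * B l k1 (w $ k1) k2 (v $ k2)))"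
      by (simp add: sum_distrib_left)
    also have "\<dots> = (\<Sum>l\<in>UNIV. c l * (\<Sum>m\<le>N l. p l * (A l m w * A l m v)))"
      unfolding B_def A_def
      by (subst sum_bilinear_rank_one) (simp add: sum_distrib_left mult_ac)
    finally show ?thesis .
  qed
  \<comment> \<open>In the mixed sums the last index of \<open>C_op\<close> is also a block index.
    Here it is the block of \<open>w\<close>, so the average over the groups falls on that side and
    produces \<open>D\<close> for \<open>w\<close>; in \<open>T3\<close> the roles of
    \<open>w\<close> and \<open>v\<close> are exchanged.\<close>
  have T2: "(\<Sum>k1\<in>UNIV. \<Sum>k2\<in>UNIV. sqrt (p k1) * sqrt (p k2) * (\<Sum>l\<in>UNIV. p l * B k1 l (w $ k1) k2 (v $ k2)))
      = (\<Sum>l\<in>UNIV. c l * (\<Sum>m\<le>N l. sqrt (p l) * (D l m w * A l m v)))"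
  proof -
    have "(\<Sum>k2\<in>UNIV. sqrt (p k1) * sqrt (p k2) * (\<Sum>l\<in>UNIV. p l * B k1 l (w $ k1) k2 (v $ k2)))
        = c k1 * (\<Sum>m\<le>N k1. sqrt (p k1) * (D k1 m w * A k1 m v))" for k1
    proof -
      have "(\<Sum>k2\<in>UNIV. sqrt (p k1) * sqrt (p k2) * (\<Sum>l\<in>UNIV. p l * B k1 l (w $ k1) k2 (v $ k2)))
        = sqrt (p k1) * (\<Sum>k2\<in>UNIV. \<Sum>l\<in>UNIV. p l * sqrt (p k2) * B k1 l (w $ k1) k2 (v $ k2))"
        by (simp add: sum_distrib_left mult_ac)
      also have "\<dots> = sqrt (p k1) * (\<Sum>l\<in>UNIV. \<Sum>k2\<in>UNIV. p l * sqrt (p k2) * B k1 l (w $ k1) k2 (v $ k2))"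
        by (subst sum.swap) simp
      also have "\<dots> = c k1 * (\<Sum>m\<le>N k1. sqrt (p k1) * (D k1 m w * A k1 m v))"
        unfolding B_def A_def D_def
        by (subst sum_bilinear_rank_one) (simp add: sum_distrib_left mult_ac)
      finally show ?thesis .
    qed
    then show ?thesis by simp
  qed
  have T3: "(\<Sum>k1\<in>UNIV. \<Sum>k2\<in>UNIV. sqrt (p k1) * sqrt (p k2) * (\<Sum>l\<in>UNIV. p l * B k2 k1 (w $ k1) l (v $ k2)))
      = (\<Sum>l\<in>UNIV. c l * (\<Sum>m\<le>N l. sqrt (p l) * (A l m w * D l m v)))"
  proof -
    have "(\<Sum>k1\<in>UNIV. sqrt (p k1) * sqrt (p k2) * (\<Sum>l\<in>UNIV. p l * B k2 k1 (w $ k1) l (v $ k2)))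
        = c k2 * (\<Sum>m\<le>N k2. sqrt (p k2) * (A k2 m w * D k2 m v))" for k2
    proof -
      have "(\<Sum>k1\<in>UNIV. sqrt (p k1) * sqrt (p k2) * (\<Sum>l\<in>UNIV. p l * B k2 k1 (w $ k1) l (v $ k2)))
        = sqrt (p k2) * (\<Sum>k1\<in>UNIV. \<Sum>l\<in>UNIV. sqrt (p k1) * p l * B k2 k1 (w $ k1) l (v $ k2))"
        by (simp add: sum_distrib_left mult_ac)
      also have "\<dots> = c k2 * (\<Sum>m\<le>N k2. sqrt (p k2) * (A k2 m w * D k2 m v))"
        unfolding B_def A_def D_def
        by (subst sum_bilinear_rank_one) (simp add: sum_distrib_left mult_ac)
      finally show ?thesis .
    qed
    then show ?thesis by (subst sum.swap) simp
  qed
  have T4: "(\<Sum>k1\<in>UNIV. \<Sum>k2\<in>UNIV. if k1 = k2 then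
        \<Sum>l1\<in>UNIV. \<Sum>l2\<in>UNIV. p l1 * p l2 * B k1 l1 (w $ k1) l2 (v $ k2) else 0)
      = (\<Sum>l\<in>UNIV. c l * (\<Sum>m\<le>N l. D l m w * D l m v))"
    unfolding B_def D_def by (simp add: sum.delta sum_bilinear_rank_one)
  have factor: "sigma_factor N x (l, m) \<bullet> w = sqrt (p l * c l) * (A l m w - D l m w / sqrt (p l))" for l m w
  proof -
    have "sigma_factor N x (l, m) \<bullet> w = (\<Sum>k\<in>UNIV. sqrt (p l * c l) *
        (sqrt (p k) * (b l m k \<bullet> (w $ k)) - (if k = l then D l m w / sqrt (p l) else 0)))"
      unfolding sigma_factor_def inner_vec_def n_def[symmetric] p_def[symmetric] b_def[symmetric]
      by (intro sum.cong refl) (auto simp: inner_diff_left inner_sum_left c_def D_def)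
    also have "\<dots> = sqrt (p l * c l) * (\<Sum>k\<in>UNIV. sqrt (p k) * (b l m k \<bullet> (w $ k))
        - (if k = l then D l m w / sqrt (p l) else 0))"
      by (simp add: sum_distrib_left)
    also have "\<dots> = sqrt (p l * c l) * (A l m w - D l m w / sqrt (p l))"
      by (simp add: A_def sum_subtractf)
    finally show ?thesis .
  qed
  have factor_prod: "(sigma_factor N x (l, m) \<bullet> w) * (sigma_factor N x (l, m) \<bullet> v)
      = c l * (p l * (A l m w * A l m v)) - c l * (sqrt (p l) * (D l m w * A l m v))
        - c l * (sqrt (p l) * (A l m w * D l m v)) + c l * (D l m w * D l m v)" for l m
  proof -
    \<comment> \<open>Distributing \<open>p l = s * s\<close> as one \<open>s\<close> per factor
      removes the division by \<open>sqrt (p l)\<close>; the product then expands into summands of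
      the four sums \<open>T1\<close> to \<open>T4\<close>.\<close>
    define s where "s = sqrt (p l)"
    have s: "s > 0" "p l = s * s" using p[of l] by (simp_all add: s_def)
    have "sqrt (p l * c l) * sqrt (p l * c l) = s * s * c l"
      using p[of l] c[of l] s by simp
    then have "(sigma_factor N x (l, m) \<bullet> w) * (sigma_factor N x (l, m) \<bullet> v)
        = s * s * c l * ((A l m w - D l m w / s) * (A l m v - D l m v / s))"
      unfolding factor s_def[symmetric] by (simp add: mult_ac)
    also have "\<dots> = c l * ((s * (A l m w - D l m w / s)) * (s * (A l m v - D l m v / s)))"
      by (simp add: mult_ac)
    also have "\<dots> = c l * ((s * A l m w - D l m w) * (s * A l m v - D l m v))"
      using s(1) by (simp add: right_diff_distrib)
    finally show ?thesis
      unfolding s_def[symmetric] s(2) using s(1) by (simp add: algebra_simps)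
  qed
  have "Sigma_op N x w \<bullet> v = (\<Sum>k1\<in>UNIV. \<Sum>k2\<in>UNIV. sigma_block N x k1 k2 (w $ k1) \<bullet> (v $ k2))"
    by (rule Sigma_op_form)
  also have "\<dots> = (\<Sum>l\<in>UNIV. c l * (\<Sum>m\<le>N l. p l * (A l m w * A l m v)))
      - (\<Sum>l\<in>UNIV. c l * (\<Sum>m\<le>N l. sqrt (p l) * (D l m w * A l m v)))
      - (\<Sum>l\<in>UNIV. c l * (\<Sum>m\<le>N l. sqrt (p l) * (A l m w * D l m v)))
      + (\<Sum>l\<in>UNIV. c l * (\<Sum>m\<le>N l. D l m w * D l m v))"
    unfolding block T1[symmetric] T2[symmetric] T3[symmetric] T4[symmetric]
      right_diff_distrib sum_subtractf sum.distrib ..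
  also have "\<dots> = (\<Sum>l\<in>UNIV. \<Sum>m\<le>N l. (sigma_factor N x (l, m) \<bullet> w) * (sigma_factor N x (l, m) \<bullet> v))"
    unfolding factor_prod by (simp add: sum.distrib sum_subtractf sum_distrib_left)
  also have "\<dots> = (\<Sum>s\<in>factor_index N. (sigma_factor N x s \<bullet> w) * (sigma_factor N x s \<bullet> v))"
    by (simp add: factor_index_def sum.Sigma)
  finally show ?thesis .
qed

lemma norm_group_mean_sign_le: "norm (group_mean_sign N x k y) \<le> 1"
proof (cases "N k = 0")
  case False
  have "norm (\<Sum>p<N k. sgn (x k p - y)) \<le> (\<Sum>p<N k. 1)"
    by (intro sum_norm_le norm_sgn_le_1)
  then show ?thesis using False by (simp add: group_mean_sign_def field_simps)
qed (simp add: group_mean_sign_def)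

lemma norm_cov_factor_le: "norm (cov_factor N x l m k) \<le> 2"
proof -
  have pair: "norm (pair_mean_sign N x k l) \<le> 1"
  proof (cases "N l = 0")
    case False
    have "norm (\<Sum>m<N l. group_mean_sign N x k (x l m)) \<le> (\<Sum>m<N l. 1)"
      by (intro sum_norm_le norm_group_mean_sign_le)
    then show ?thesis using False by (simp add: sum_group_mean_sign)
  qed (simp add: pair_mean_sign_def)
  then show ?thesis
    using norm_group_mean_sign_le[of N x k "x l m"]
    by (auto simp: cov_factor_def intro: norm_triangle_ineq4[THEN order_trans])
qed

text \<open>The constant is \<open>16 * 3\<close>. With \<open>c l = 1 / (N l - 1)\<close>, each
  component of a factor has norm at most \<open>4 * sqrt (c l)\<close>, because the leading
  \<open>sqrt (p l)\<close> absorbs the reciprocal root and \<open>p l \<le> 1\<close>. A group has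
  \<open>N l + 1\<close> factors, and \<open>(N l + 1) / (N l - 1) \<le> 3\<close> with equality at
  \<open>N l = 2\<close>. Components and groups contribute \<open>CARD('k)\<close> each.\<close>

lemma sum_norm_sigma_factor_le:
  fixes x :: "'k::finite \<Rightarrow> nat \<Rightarrow> 'a::real_inner"
  assumes N: "\<And>k. N k \<ge> 2"
  shows "(\<Sum>s\<in>factor_index N. (norm (sigma_factor N x s))\<^sup>2) \<le> 48 * (real CARD('k))\<^sup>2"
proof -
  define n where "n = real (total_size N)"
  define p where "p k = real (N k) / n" for k
  define c where "c l = 1 / (real (N l) - 1)" for l
  define b where "b = cov_factor N x"
  let ?K = "real CARD('k)"
  have n: "n > 0"
    unfolding n_def total_size_def using N by (auto intro!: sum_pos intro: less_le_trans[of 0 2])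
  have p: "p k > 0" for k using n N[of k] by (simp add: p_def)
  have c: "c k > 0" for k using N[of k] by (simp add: c_def)
  have sum_p: "(\<Sum>k\<in>UNIV. p k) = 1"
    using n by (simp add: p_def sum_divide_distrib[symmetric] n_def total_size_def)
  then have p1: "p k \<le> 1" for k
    using member_le_sum[of k UNIV p] p by (simp add: less_imp_le)
  have b: "norm (b l m k) \<le> 2" for l m k
    unfolding b_def by (rule norm_cov_factor_le)
  have comp: "(norm (sigma_factor N x (l, m) $ k))\<^sup>2 \<le> 16 * c l" for l m k
  proof -
    have "norm (\<Sum>i\<in>UNIV. p i *\<^sub>R b l m i) \<le> (\<Sum>i\<in>UNIV. p i * 2)"
      using p b by (intro sum_norm_le) (simp add: mult_left_mono less_imp_le)
    also have "\<dots> = 2" by (simp add: sum_distrib_right[symmetric] sum_p)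
    finally have mean: "norm (\<Sum>i\<in>UNIV. p i *\<^sub>R b l m i) \<le> 2" .
    have first: "norm (sqrt (p k) *\<^sub>R b l m k) \<le> 1 * 2"
      unfolding norm_scaleR using p[of k] p1[of k] b by (intro mult_mono) auto
    have "norm (sigma_factor N x (l, m) $ k) = sqrt (p l * c l) * norm (sqrt (p k) *\<^sub>R b l m k
        - (if k = l then (1 / sqrt (p l)) *\<^sub>R (\<Sum>i\<in>UNIV. p i *\<^sub>R b l m i) else 0))"
      unfolding sigma_factor_def n_def[symmetric] p_def[symmetric] b_def[symmetric]
      using p[of l] c[of l] by (simp add: c_def)
    also have "\<dots> \<le> sqrt (p l * c l) * (2 + (1 / sqrt (p l)) * 2)"
    proof (intro mult_left_mono)
      have "norm (sqrt (p k) *\<^sub>R b l m k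
          - (if k = l then (1 / sqrt (p l)) *\<^sub>R (\<Sum>i\<in>UNIV. p i *\<^sub>R b l m i) else 0))
        \<le> norm (sqrt (p k) *\<^sub>R b l m k)
          + norm (if k = l then (1 / sqrt (p l)) *\<^sub>R (\<Sum>i\<in>UNIV. p i *\<^sub>R b l m i) else 0)"
        by (rule norm_triangle_ineq4)
      also have "\<dots> \<le> 2 + (1 / sqrt (p l)) * 2"
        using first mean p[of l] by (intro add_mono) (auto simp: divide_right_mono)
      finally show "norm (sqrt (p k) *\<^sub>R b l m k
          - (if k = l then (1 / sqrt (p l)) *\<^sub>R (\<Sum>i\<in>UNIV. p i *\<^sub>R b l m i) else 0))
        \<le> 2 + (1 / sqrt (p l)) * 2" .
    qed (use p[of l] c[of l] in simp)
    also have "\<dots> = sqrt (c l) * (2 * sqrt (p l) + 2)"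
      using p[of l] by (simp add: real_sqrt_mult field_simps)
    also have "\<dots> \<le> sqrt (c l) * 4"
      using p1[of l] c[of l] by (intro mult_left_mono) auto
    finally have "(norm (sigma_factor N x (l, m) $ k))\<^sup>2 \<le> (sqrt (c l) * 4)\<^sup>2"
      by (intro power_mono) auto
    then show ?thesis using c[of l] by (simp add: power_mult_distrib)
  qed
  have one: "(norm (sigma_factor N x (l, m)))\<^sup>2 \<le> ?K * (16 * c l)" for l m
    using comp[of l m] sum_bounded_above[of UNIV "\<lambda>k. (norm (sigma_factor N x (l, m) $ k))\<^sup>2" "16 * c l"]
    by (simp add: norm_vec_def L2_set_def sum_nonneg)
  have "(\<Sum>s\<in>factor_index N. (norm (sigma_factor N x s))\<^sup>2)
      = (\<Sum>l\<in>UNIV. \<Sum>m\<le>N l. (norm (sigma_factor N x (l, m)))\<^sup>2)"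
    by (simp add: factor_index_def sum.Sigma)
  also have "\<dots> \<le> (\<Sum>l\<in>UNIV. real (Suc (N l)) * (?K * (16 * c l)))"
    using one by (intro sum_mono sum_bounded_above[THEN order_trans]) auto
  also have "\<dots> \<le> (\<Sum>l\<in>(UNIV::'k set). 48 * ?K)"
  proof (intro sum_mono)
    fix l
    have "real (Suc (N l)) * c l \<le> 3" using N[of l] by (simp add: c_def field_simps)
    then have "16 * ?K * (real (Suc (N l)) * c l) \<le> 16 * ?K * 3" by (intro mult_left_mono) auto
    then show "real (Suc (N l)) * (?K * (16 * c l)) \<le> 48 * ?K" by (simp add: mult_ac)
  qed
  also have "\<dots> = 48 * ?K\<^sup>2" by (simp add: power2_eq_square)
  finally show ?thesis .
qed

subsection \<open>The p-value of the asymptotic procedure\<close>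

text \<open>The explicit law shows that the choice is not void, and uniqueness identifies the chosen
  law with it. In the new form the sample occurs only inside an inequality on a fixed probability
  space.\<close>

lemma asymptotic_pvalue_eq:
  fixes x :: "'k::finite \<Rightarrow> nat \<Rightarrow> 'a::{real_inner, banach, second_countable_topology}"
  assumes N: "\<And>k. N k \<ge> 2"
  shows "asymptotic_pvalue N x = measure (iid_std_normal (factor_index N))
     {z \<in> space (iid_std_normal (factor_index N)).
       SS N x \<le> (norm (\<Sum>s\<in>factor_index N. z s *\<^sub>R sigma_factor N x s))\<^sup>2}"
proof -
  let ?G = "iid_std_normal (factor_index N)"
  let ?F = "\<lambda>z. \<Sum>s\<in>factor_index N. z s *\<^sub>R sigma_factor N x s"
  have comp: "(\<lambda>z. z s) \<in> borel_measurable ?G" if "s \<in> factor_index N" for s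
    using integrable_iid_std_normal[OF that] by auto
  then have F [measurable]: "?F \<in> borel_measurable ?G"
    by (intro borel_measurable_sum borel_measurable_scaleR) auto
  have "gaussian_law (distr ?G borel ?F) 0 (Sigma_op N x)"
    by (rule gaussian_law_std_normal_combination) (simp_all add: Sigma_op_rank_one_sum N)
  then have "(SOME Q. gaussian_law Q 0 (Sigma_op N x)) = distr ?G borel ?F"
    by (intro some_equality gaussian_law_unique)
  then have "asymptotic_pvalue N x = measure (distr ?G borel ?F) {w. (norm w)\<^sup>2 \<ge> SS N x}"
    by (simp add: asymptotic_pvalue_def)
  also have "\<dots> = measure ?G (?F -` {w. (norm w)\<^sup>2 \<ge> SS N x} \<inter> space ?G)"
    by (intro measure_distr) auto
  also have "?F -` {w. (norm w)\<^sup>2 \<ge> SS N x} \<inter> space ?G = {z \<in> space ?G. SS N x \<le> (norm (?F z))\<^sup>2}"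
    by auto
  finally show ?thesis .
qed

lemma asymptotic_pvalue_le:
  fixes x :: "'k::finite \<Rightarrow> nat \<Rightarrow> 'a::{real_inner, banach, second_countable_topology}"
  assumes N: "\<And>k. N k \<ge> 2" and SS: "SS N x > 0"
  shows "asymptotic_pvalue N x \<le> 48 * (real CARD('k))\<^sup>2 / SS N x"
proof -
  interpret prob_space "iid_std_normal (factor_index N)" by (rule prob_space_iid_std_normal)
  have "asymptotic_pvalue N x
      \<le> (\<integral>z. (norm (\<Sum>s\<in>factor_index N. z s *\<^sub>R sigma_factor N x s))\<^sup>2
            \<partial>iid_std_normal (factor_index N)) / SS N x"
    unfolding asymptotic_pvalue_eq[of N x, OF N]
    by (intro integral_Markov_inequality_measure[where A = "{}"] std_normal_combination_second_moment SS) auto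
  also have "\<dots> \<le> 48 * (real CARD('k))\<^sup>2 / SS N x"
    unfolding std_normal_combination_second_moment(2)[OF finite_factor_index]
    using sum_norm_sigma_factor_le[of N x, OF N] SS by (intro divide_right_mono) auto
  finally show ?thesis .
qed

text \<open>The function is the sum of its components embedded along the coordinate axes, and these
  embeddings are continuous. Measurability of the sum relies on second countability of the product
  type.\<close>

lemma borel_measurable_vec:
  fixes f :: "'w \<Rightarrow> 'a::{real_inner, second_countable_topology} ^ 'k::finite"
  assumes "\<And>k. (\<lambda>\<omega>. f \<omega> $ k) \<in> borel_measurable M"
  shows "f \<in> borel_measurable M"
proof -
  have cont: "continuous_on UNIV (\<lambda>a :: 'a. axis k a :: 'a ^ 'k)" for k
  proof -
    have "continuous_on UNIV (\<lambda>a :: 'a. if i = k then a else 0)" for i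
      by (cases "i = k") auto
    then show ?thesis unfolding axis_def by (intro continuous_on_vec_lambda)
  qed
  have "f = (\<lambda>\<omega>. \<Sum>k\<in>UNIV. axis k (f \<omega> $ k))"
    by (auto simp: fun_eq_iff vec_eq_iff axis_def if_distrib cong: if_cong)
  also have "\<dots> \<in> borel_measurable M"
    by (rule borel_measurable_sum)
       (rule measurable_compose[OF assms borel_measurable_continuous_onI[OF cont]])
  finally show ?thesis .
qed

section \<open>Measurability of the statistics in the sample\<close>

context
  fixes M :: "'w measure" and X :: "'k::finite \<Rightarrow> nat \<Rightarrow> 'w \<Rightarrow> 'a::{real_inner, second_countable_topology}"
  assumes X [measurable]: "\<And>k i. X k i \<in> borel_measurable M"
begin

lemma borel_measurable_mean_rank:
  "(\<lambda>\<omega>. mean_rank N (\<lambda>k i. X k i \<omega>) k) \<in> borel_measurable M"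
  unfolding mean_rank_def spatial_rank_def by measurable

lemma borel_measurable_SS: "(\<lambda>\<omega>. SS N (\<lambda>k i. X k i \<omega>)) \<in> borel_measurable M"
proof -
  note [measurable] = borel_measurable_mean_rank
  show ?thesis unfolding SS_eq by measurable
qed

lemma borel_measurable_sigma_factor:
  "(\<lambda>\<omega>. sigma_factor N (\<lambda>k i. X k i \<omega>) s) \<in> borel_measurable M"
proof (rule borel_measurable_vec)
  fix k
  have "(\<lambda>\<omega>. cov_factor N (\<lambda>k i. X k i \<omega>) l m k) \<in> borel_measurable M" for l m k
    unfolding cov_factor_def group_mean_sign_def pair_mean_sign_def by measurable
  note [measurable] = this
  obtain l m where s: "s = (l, m)" by (cases s)
  show "(\<lambda>\<omega>. sigma_factor N (\<lambda>k i. X k i \<omega>) s $ k) \<in> borel_measurable M"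
    unfolding s sigma_factor_def split vec_lambda_beta by measurable
qed

end

text \<open>By \<open>asymptotic_pvalue_eq\<close> the p-value is the measure of a section of a
  jointly measurable set. Measurability of the rejection event is what permits bounding its
  probability below by that of a smaller event.\<close>

lemma borel_measurable_asymptotic_pvalue:
  fixes X :: "'k::finite \<Rightarrow> nat \<Rightarrow> 'w \<Rightarrow> 'a::{real_inner, banach, second_countable_topology}"
  assumes N: "\<And>k. N k \<ge> 2" and X: "\<And>k i. X k i \<in> borel_measurable M"
  shows "(\<lambda>\<omega>. asymptotic_pvalue N (\<lambda>k i. X k i \<omega>)) \<in> borel_measurable M"
proof -
  let ?I = "factor_index N"
  let ?G = "iid_std_normal ?I"
  interpret G: prob_space ?G by (rule prob_space_iid_std_normal)
  have SS [measurable]: "(\<lambda>p. SS N (\<lambda>k i. X k i (fst p))) \<in> borel_measurable (M \<Otimes>\<^sub>M ?G)"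
    by (rule measurable_compose[OF measurable_fst borel_measurable_SS[OF X]])
  have F [measurable]: "(\<lambda>p. \<Sum>s\<in>?I. snd p s *\<^sub>R sigma_factor N (\<lambda>k i. X k i (fst p)) s)
      \<in> borel_measurable (M \<Otimes>\<^sub>M ?G)"
  proof (rule borel_measurable_sum, rule borel_measurable_scaleR)
    fix s assume "s \<in> ?I"
    then have "(\<lambda>z. z s) \<in> borel_measurable ?G"
      by (rule borel_measurable_integrable[OF integrable_iid_std_normal])
    then show "(\<lambda>p. snd p s) \<in> borel_measurable (M \<Otimes>\<^sub>M ?G)"
      by (rule measurable_compose[OF measurable_snd])
    show "(\<lambda>p. sigma_factor N (\<lambda>k i. X k i (fst p)) s) \<in> borel_measurable (M \<Otimes>\<^sub>M ?G)"
      by (rule measurable_compose[OF measurable_fst borel_measurable_sigma_factor[OF X]])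
  qed
  let ?S = "{p \<in> space (M \<Otimes>\<^sub>M ?G). SS N (\<lambda>k i. X k i (fst p))
      \<le> (norm (\<Sum>s\<in>?I. snd p s *\<^sub>R sigma_factor N (\<lambda>k i. X k i (fst p)) s))\<^sup>2}"
  have "?S \<in> sets (M \<Otimes>\<^sub>M ?G)"
    by (rule borel_measurable_le[OF SS borel_measurable_power[OF measurable_compose[OF F borel_measurable_norm]]])
  then have "(\<lambda>\<omega>. emeasure ?G (Pair \<omega> -` ?S)) \<in> borel_measurable M"
    by (rule G.measurable_emeasure_Pair)
  then have "(\<lambda>\<omega>. measure ?G (Pair \<omega> -` ?S)) \<in> borel_measurable M"
    unfolding measure_def by measurable
  also have "?this \<longleftrightarrow> ?thesis"
    unfolding asymptotic_pvalue_eq[of N, OF N]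
    by (rule measurable_cong, rule arg_cong[where f = "measure ?G"]) (auto simp: space_pair_measure)
  finally show ?thesis .
qed

subsection \<open>Resampling\<close>

text \<open>Markov's inequality is applied twice: to the resampled statistic, which bounds the
  exceedance probability by \<open>C / SS N x\<close>, and then to the p-value, whose mean by
  linearity is no larger. The result is uniform in \<open>B\<close>.\<close>

lemma resampling_rejection_prob_ge:
  assumes D: "finite (set_pmf D)" and \<alpha>: "\<alpha> > 0" and SS: "SS N x > 0"
    and moment: "(\<integral>f. SS N (resample x f) \<partial>measure_pmf D) \<le> C"
  shows "1 - C / (\<alpha> * SS N x) \<le> resampling_rejection_prob D \<alpha> N B x"
proof -
  define R where "R = Pi_pmf {..<B} undefined (\<lambda>_. D)"
  define exceed where "exceed f = (if SS N x < SS N (resample x f) then 1 else 0 :: real)" for f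
  have "finite (set_pmf R)"
    unfolding R_def by (rule finite_subset[OF set_Pi_pmf_subset']) (auto intro!: finite_PiE_dflt D)
  then have R_int: "integrable (measure_pmf R) g" for g :: "_ \<Rightarrow> real"
    by (rule integrable_measure_pmf_finite)
  have D_int: "integrable (measure_pmf D) g" for g :: "_ \<Rightarrow> real"
    using D by (rule integrable_measure_pmf_finite)
  have "0 \<le> (\<integral>f. SS N (resample x f) \<partial>measure_pmf D)"
    by (simp add: SS_def)
  with moment have C: "C \<ge> 0" by linarith
  have pval: "resampling_pvalue N x B d = (\<Sum>b<B. exceed (d b)) / real B" for d
  proof -
    have "{..<B} \<inter> {b. SS N x < SS N (resample x (d b))} = {b. b < B \<and> SS N (resample x (d b)) > SS N x}"
      by auto
    then show ?thesis by (simp add: resampling_pvalue_def exceed_def sum.If_cases)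
  qed
  have "exceed f = indicator {f. SS N x < SS N (resample x f)} f" for f
    by (simp add: exceed_def indicator_def)
  then have "(\<integral>f. exceed f \<partial>measure_pmf D) = measure (measure_pmf D) {f. SS N x < SS N (resample x f)}"
    by simp
  also have "\<dots> \<le> measure (measure_pmf D) {f \<in> space (measure_pmf D). SS N x \<le> SS N (resample x f)}"
    by (intro measure_pmf.finite_measure_mono) auto
  also have "\<dots> \<le> (\<integral>f. SS N (resample x f) \<partial>measure_pmf D) / SS N x"
    using SS by (intro integral_Markov_inequality_measure[where A = "{}"] D_int) (auto simp: SS_def)
  also have "\<dots> \<le> C / SS N x" using moment SS by (intro divide_right_mono) auto
  finally have exceed: "(\<integral>f. exceed f \<partial>measure_pmf D) \<le> C / SS N x" .
  have "(\<integral>d. resampling_pvalue N x B d \<partial>measure_pmf R)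
      = (\<Sum>b<B. \<integral>d. exceed (d b) \<partial>measure_pmf R) / real B"
    unfolding pval by (simp add: Bochner_Integration.integral_sum R_int)
  also have "\<dots> = (\<Sum>b<B. \<integral>f. exceed f \<partial>measure_pmf D) / real B"
  proof (intro arg_cong2[where f = "(/)"] sum.cong refl)
    fix b assume "b \<in> {..<B}"
    then have "map_pmf (\<lambda>d. d b) R = D"
      unfolding R_def by (simp add: Pi_pmf_component)
    then have "(\<integral>f. exceed f \<partial>measure_pmf D) = (\<integral>f. exceed f \<partial>measure_pmf (map_pmf (\<lambda>d. d b) R))"
      by simp
    then show "(\<integral>d. exceed (d b) \<partial>measure_pmf R) = (\<integral>f. exceed f \<partial>measure_pmf D)"
      by simp
  qed
  \<comment> \<open>For \<open>B = 0\<close> the quotient is 0 by the convention on division, and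
    \<open>C \<ge> 0\<close> closes the case.\<close>
  also have "\<dots> \<le> C / SS N x"
    using exceed C SS by (cases "B = 0") auto
  finally have mean: "(\<integral>d. resampling_pvalue N x B d \<partial>measure_pmf R) \<le> C / SS N x" .
  have "measure (measure_pmf R) (- {d. resampling_pvalue N x B d \<le> \<alpha>})
      \<le> measure (measure_pmf R) {d \<in> space (measure_pmf R). \<alpha> \<le> resampling_pvalue N x B d}"
    by (intro measure_pmf.finite_measure_mono) auto
  also have "\<dots> \<le> (\<integral>d. resampling_pvalue N x B d \<partial>measure_pmf R) / \<alpha>"
    using \<alpha> by (intro integral_Markov_inequality_measure[where A = "{}"] R_int)
      (auto simp: resampling_pvalue_def)
  also have "\<dots> \<le> C / SS N x / \<alpha>" using mean \<alpha> by (intro divide_right_mono) auto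
  finally show ?thesis
    unfolding resampling_rejection_prob_def R_def[symmetric]
    using measure_pmf.prob_compl[of "{d. resampling_pvalue N x B d \<le> \<alpha>}" R]
    by (simp add: Compl_eq_Diff_UNIV field_simps)
qed

text \<open>Finite support makes the conditional probability a finite sum of fixed weights times
  indicators of events about the sample; a fixed index map turns the sample into another measurable
  array.\<close>

lemma borel_measurable_resampling_rejection_prob:
  fixes X :: "'k::finite \<Rightarrow> nat \<Rightarrow> 'w \<Rightarrow> 'a::{real_inner, second_countable_topology}"
  assumes D: "finite (set_pmf D)" and X: "\<And>k i. X k i \<in> borel_measurable M"
  shows "(\<lambda>\<omega>. resampling_rejection_prob D \<alpha> N B (\<lambda>k i. X k i \<omega>)) \<in> borel_measurable M"
proof -
  define R where "R = Pi_pmf {..<B} undefined (\<lambda>_. D)"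
  have fin: "finite (set_pmf R)"
    unfolding R_def by (rule finite_subset[OF set_Pi_pmf_subset']) (auto intro!: finite_PiE_dflt D)
  have prob: "measure_pmf.prob R {d. Q d} = (\<Sum>d\<in>set_pmf R. pmf R d * (if Q d then 1 else 0))" for Q
  proof -
    have "measure_pmf.prob R {d. Q d} = (\<integral>d. indicator {d. Q d} d \<partial>measure_pmf R)" by simp
    also have "\<dots> = (\<Sum>d\<in>set_pmf R. pmf R d * indicator {d. Q d} d)"
      by (subst integral_measure_pmf[OF fin]) auto
    finally show ?thesis by (simp add: indicator_def of_bool_def)
  qed
  have [measurable]: "(\<lambda>\<omega>. SS N (\<lambda>k i. X k i \<omega>)) \<in> borel_measurable M"
    by (rule borel_measurable_SS[OF X])
  have [measurable]: "(\<lambda>\<omega>. SS N (resample (\<lambda>k i. X k i \<omega>) f)) \<in> borel_measurable M" for f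
  proof -
    have "resample (\<lambda>k i. X k i \<omega>) f = (\<lambda>k i. X (fst (f (k, i))) (snd (f (k, i))) \<omega>)" for \<omega>
      by (simp add: fun_eq_iff resample_def split_beta)
    then show ?thesis by (simp add: borel_measurable_SS X)
  qed
  have [measurable]: "(\<lambda>\<omega>. resampling_pvalue N (\<lambda>k i. X k i \<omega>) B d) \<in> borel_measurable M" for d
    unfolding resampling_pvalue_def by measurable
  show ?thesis
    unfolding resampling_rejection_prob_def R_def[symmetric] prob by measurable
qed

lemma resampling_rejection_prob_bounds:
  "0 \<le> resampling_rejection_prob D \<alpha> N B x" "resampling_rejection_prob D \<alpha> N B x \<le> 1"
  by (simp_all add: resampling_rejection_prob_def)

lemma finite_pooled_index [simp]: "finite (pooled_index N)"
  by (simp add: pooled_index_def)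

lemma
  fixes x :: "'k::finite \<Rightarrow> nat \<Rightarrow> 'a::{real_inner, second_countable_topology}"
  shows finite_set_permutation_pmf: "finite (set_pmf (permutation_pmf (N :: 'k \<Rightarrow> nat)))"
    and permutation_second_moment:
      "(\<integral>f. SS N (resample x f) \<partial>measure_pmf (permutation_pmf N)) \<le> (real CARD('k))\<^sup>2"
proof -
  let ?S = "{\<pi>. \<pi> permutes pooled_index N}"
  have S: "finite ?S" "?S \<noteq> {}"
    using finite_permutations[OF finite_pooled_index] permutes_id by blast+
  show "finite (set_pmf (permutation_pmf N))"
    using S by (simp add: permutation_pmf_def)
  show "(\<integral>f. SS N (resample x f) \<partial>measure_pmf (permutation_pmf N)) \<le> (real CARD('k))\<^sup>2"
    unfolding permutation_pmf_def
    by (rule resample_second_moment[OF S]) (auto intro: permutes_compose permutes_swap_id)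
qed

text \<open>Independent uniform draws from a nonempty pool amount to the uniform law on all index
  maps into it, which puts the bootstrap in the same setting as the permutations.\<close>

lemma
  fixes x :: "'k::finite \<Rightarrow> nat \<Rightarrow> 'a::{real_inner, second_countable_topology}"
  assumes N: "total_size N > 0"
  shows finite_set_bootstrap_pmf: "finite (set_pmf (bootstrap_pmf N))"
    and bootstrap_second_moment:
      "(\<integral>f. SS N (resample x f) \<partial>measure_pmf (bootstrap_pmf N)) \<le> (real CARD('k))\<^sup>2"
proof -
  let ?P = "pooled_index N"
  let ?S = "PiE_dflt ?P undefined (\<lambda>_. ?P)"
  obtain k where "N k > 0"
    using N unfolding total_size_def by (metis gr0I less_irrefl sum.neutral)
  then have "(k, 0) \<in> ?P" by (simp add: pooled_index_def)
  then have "?P \<noteq> {}" by blast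
  then have eq: "bootstrap_pmf N = pmf_of_set ?S"
    unfolding bootstrap_pmf_def by (intro Pi_pmf_of_set) auto
  have S: "finite ?S" "?S \<noteq> {}"
    using \<open>?P \<noteq> {}\<close> by (auto simp: PiE_dflt_empty_iff intro!: finite_PiE_dflt)
  show "finite (set_pmf (bootstrap_pmf N))"
    unfolding eq using S by simp
  show "(\<integral>f. SS N (resample x f) \<partial>measure_pmf (bootstrap_pmf N)) \<le> (real CARD('k))\<^sup>2"
    unfolding eq
  proof (rule resample_second_moment[OF S])
    fix f p q assume "f \<in> ?S" "p \<in> ?P" "q \<in> ?P"
    then show "f \<circ> Transposition.transpose p q \<in> ?S"
      by (auto simp: PiE_dflt_def Transposition.transpose_def simp del: split_paired_All)
  qed
qed

subsection \<open>The sample under the alternative\<close>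

lemma norm_mean_rank_le: "norm (mean_rank N x k) \<le> 1"
proof -
  have rank: "norm (spatial_rank N x y) \<le> 1" for y
  proof -
    have "norm (\<Sum>k\<in>UNIV. \<Sum>i<N k. sgn (y - x k i)) \<le> (\<Sum>k\<in>UNIV. \<Sum>i<N k. 1)"
      by (intro sum_norm_le norm_sgn_le_1)
    also have "\<dots> = real (total_size N)" by (simp add: total_size_def)
    finally show ?thesis
      by (cases "total_size N = 0") (simp_all add: spatial_rank_def field_simps)
  qed
  have "norm (\<Sum>i<N k. spatial_rank N x (x k i)) \<le> (\<Sum>i<N k. 1)"
    by (intro sum_norm_le rank)
  then show ?thesis by (cases "N k = 0") (simp_all add: mean_rank_def field_simps)
qed

text \<open>The joint law is a product, so Fubini's theorem gives an iterated Bochner integral, and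
  the inner product, linear and continuous in each argument, is pulled out of both
  integrals.\<close>

lemma (in prob_space) indep_var_expectation_inner:
  fixes U V :: "'a \<Rightarrow> 'b::{real_inner, banach, second_countable_topology}"
  assumes indep: "indep_var borel U borel V"
    and bound: "\<And>\<omega>. norm (U \<omega>) \<le> b" "\<And>\<omega>. norm (V \<omega>) \<le> b"
  shows "(\<integral>\<omega>. U \<omega> \<bullet> V \<omega> \<partial>M) = (\<integral>\<omega>. U \<omega> \<partial>M) \<bullet> (\<integral>\<omega>. V \<omega> \<partial>M)"
proof -
  have U [measurable]: "U \<in> borel_measurable M" and V [measurable]: "V \<in> borel_measurable M"
    using indep by (auto simp: indep_var_distribution_eq)
  have joint: "distr M borel U \<Otimes>\<^sub>M distr M borel V = distr M (borel \<Otimes>\<^sub>M borel) (\<lambda>\<omega>. (U \<omega>, V \<omega>))"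
    using indep by (simp add: indep_var_distribution_eq)
  interpret DU: prob_space "distr M borel U" by (rule prob_space_distr) simp
  interpret DV: prob_space "distr M borel V" by (rule prob_space_distr) simp
  interpret DUV: pair_prob_space "distr M borel U" "distr M borel V" ..
  have int_U: "integrable M U" and int_V: "integrable M V"
    by (rule integrable_bounded[OF U bound(1)], rule integrable_bounded[OF V bound(2)])
  have "\<bar>U \<omega> \<bullet> V \<omega>\<bar> \<le> b * b" for \<omega>
    using bound order_trans[OF norm_ge_zero bound(1)]
    by (intro order_trans[OF Cauchy_Schwarz_ineq2] mult_mono) auto
  then have "integrable M (\<lambda>\<omega>. U \<omega> \<bullet> V \<omega>)"
    by (intro integrable_bounded[where b = "b * b"] borel_measurable_inner) auto
  then have int: "integrable (distr M borel U \<Otimes>\<^sub>M distr M borel V) (\<lambda>(u, v). u \<bullet> v)"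
    unfolding joint by (subst integrable_distr_eq) (auto simp: split_beta')
  have "(\<integral>\<omega>. U \<omega> \<bullet> V \<omega> \<partial>M) = (\<integral>p. fst p \<bullet> snd p \<partial>(distr M borel U \<Otimes>\<^sub>M distr M borel V))"
    unfolding joint by (subst integral_distr) auto
  also have "\<dots> = (\<integral>u. (\<integral>v. u \<bullet> v \<partial>distr M borel V) \<partial>distr M borel U)"
    using DUV.integral_fst'[OF int] by (simp add: split_beta')
  also have "\<dots> = (\<integral>\<omega>. (\<integral>\<omega>'. U \<omega> \<bullet> V \<omega>' \<partial>M) \<partial>M)"
    by (simp add: integral_distr)
  also have "\<dots> = (\<integral>\<omega>. U \<omega> \<bullet> (\<integral>\<omega>'. V \<omega>' \<partial>M) \<partial>M)"
    by (simp add: integral_inner_right int_V)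
  also have "\<dots> = (\<integral>\<omega>. U \<omega> \<partial>M) \<bullet> (\<integral>\<omega>. V \<omega> \<partial>M)"
    by (simp add: integral_inner_left int_U)
  finally show ?thesis .
qed

locale k_sample = prob_space M for M :: "'w measure" +
  fixes P :: "'k::finite \<Rightarrow> ('a::{real_inner, banach, second_countable_topology}) measure"
    and X :: "'k \<Rightarrow> nat \<Rightarrow> 'w \<Rightarrow> 'a"
  assumes indep: "indep_vars (\<lambda>_. borel) (\<lambda>(k, i). X k i) UNIV"
    and law: "\<And>k i. distr M borel (X k i) = P k"
begin

text \<open>For \<open>k = l\<close> an observation is subtracted from itself and the value is 0.
  This agrees with the expectation for two independent observations of one group, which vanishes by
  symmetry.\<close>

definition theta :: "'k \<Rightarrow> 'k \<Rightarrow> 'a" where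
  "theta k l = (\<integral>\<omega>. sgn (X k 0 \<omega> - X l 0 \<omega>) \<partial>M)"

lemma theta_self [simp]: "theta k k = 0"
  by (simp add: theta_def)

lemma X_measurable [measurable]: "X k i \<in> borel_measurable M"
  using indep unfolding indep_vars_def by (auto dest!: bspec[of _ _ "(k, i)"])

lemma integrable_sgn_diff: "integrable M (\<lambda>\<omega>. sgn (X k i \<omega> - X l j \<omega>))"
  by (rule integrable_bounded[where b = 1]) (simp_all add: norm_sgn_le_1)

lemma indep_var_compose_restrict:
  assumes A: "A \<inter> A' = {}"
    and f: "f \<in> PiM A (\<lambda>_. borel) \<rightarrow>\<^sub>M borel" and g: "g \<in> PiM A' (\<lambda>_. borel) \<rightarrow>\<^sub>M borel"
  shows "indep_var borel (\<lambda>\<omega>. f (\<lambda>p\<in>A. X (fst p) (snd p) \<omega>)) borel (\<lambda>\<omega>. g (\<lambda>p\<in>A'. X (fst p) (snd p) \<omega>))"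
proof -
  have "indep_var (PiM A (\<lambda>_. borel)) (\<lambda>\<omega>. \<lambda>p\<in>A. (\<lambda>(k, i). X k i) p \<omega>)
      (PiM A' (\<lambda>_. borel)) (\<lambda>\<omega>. \<lambda>p\<in>A'. (\<lambda>(k, i). X k i) p \<omega>)"
    using indep A by (intro indep_var_restrict) auto
  from indep_var_compose[OF this f g] show ?thesis
    by (simp add: comp_def split_beta')
qed

lemma expectation_sgn_diff:
  assumes "k \<noteq> l"
  shows "(\<integral>\<omega>. sgn (X k i \<omega> - X l j \<omega>) \<partial>M) = theta k l"
proof -
  have *: "(\<integral>\<omega>. sgn (X k i \<omega> - X l j \<omega>) \<partial>M) = (\<integral>p. sgn (fst p - snd p) \<partial>(P k \<Otimes>\<^sub>M P l))" for i j
  proof -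
    have m: "(\<lambda>f. f (k, i)) \<in> PiM {(k, i)} (\<lambda>_. borel) \<rightarrow>\<^sub>M borel"
      "(\<lambda>f. f (l, j)) \<in> PiM {(l, j)} (\<lambda>_. borel) \<rightarrow>\<^sub>M borel"
      by (auto intro: measurable_component_singleton)
    have "indep_var borel (X k i) borel (X l j)"
      using indep_var_compose_restrict[OF _ m] assms by simp
    then have "P k \<Otimes>\<^sub>M P l = distr M (borel \<Otimes>\<^sub>M borel) (\<lambda>\<omega>. (X k i \<omega>, X l j \<omega>))"
      by (simp add: indep_var_distribution_eq law)
    then show ?thesis by (simp add: integral_distr)
  qed
  show ?thesis unfolding theta_def * ..
qed

text \<open>The two summands depend on disjoint sets of observations, because the groups differ and
  no index within a group is shared; independence factors the expectation, and each factor is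
  centred.\<close>

lemma sgn_diff_uncorrelated:
  assumes kl: "k \<noteq> l" and ij: "i \<noteq> i'" "j \<noteq> j'"
  shows "(\<integral>\<omega>. (sgn (X k i \<omega> - X l j \<omega>) - theta k l) \<bullet> (sgn (X k i' \<omega> - X l j' \<omega>) - theta k l) \<partial>M) = 0"
proof -
  let ?h = "\<lambda>i j \<omega>. sgn (X k i \<omega> - X l j \<omega>) - theta k l"
  have m: "(\<lambda>f. sgn (f (k, i) - f (l, j)) - theta k l) \<in> PiM {(k, i), (l, j)} (\<lambda>_. borel) \<rightarrow>\<^sub>M borel" for i j
    by (intro borel_measurable_diff measurable_compose[OF _ borel_measurable_sgn_vector]
        borel_measurable_const measurable_component_singleton) auto
  have indep: "indep_var borel (?h i j) borel (?h i' j')"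
    using indep_var_compose_restrict[OF _ m m, of i j i' j'] kl ij by simp
  have bound: "norm (?h i j \<omega>) \<le> 1 + norm (theta k l)" for i j \<omega>
    by (intro norm_triangle_ineq4[THEN order_trans] add_mono norm_sgn_le_1) simp
  have "(\<integral>\<omega>. ?h i j \<omega> \<bullet> ?h i' j' \<omega> \<partial>M) = (\<integral>\<omega>. ?h i j \<omega> \<partial>M) \<bullet> (\<integral>\<omega>. ?h i' j' \<omega> \<partial>M)"
    by (rule indep_var_expectation_inner[OF indep bound bound])
  also have "(\<integral>\<omega>. ?h i j \<omega> \<partial>M) = 0"
    using kl by (simp add: integrable_sgn_diff expectation_sgn_diff prob_space)
  finally show ?thesis by simp
qed

text \<open>Weighted by the actual proportions rather than their limits, this is the exact mean of
  \<open>mean_rank\<close> for every nonempty group \<open>k\<close>, so centring leaves no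
  bias.\<close>

definition drift :: "('k \<Rightarrow> nat) \<Rightarrow> 'k \<Rightarrow> 'a" where
  "drift N k = (\<Sum>l\<in>UNIV. (real (N l) / real (total_size N)) *\<^sub>R theta k l)"

text \<open>Spreading the drift evenly over the \<open>N k * N l\<close> pairs centres each sign
  separately and gives the shape required by \<open>second_moment_group\<close>.\<close>

lemma mean_rank_minus_drift:
  assumes N: "N k > 0"
  shows "mean_rank N (\<lambda>k i. X k i \<omega>) k - drift N k = (\<Sum>l\<in>UNIV - {k}.
     (1 / (real (total_size N) * real (N k))) *\<^sub>R
       (\<Sum>i<N k. \<Sum>j<N l. sgn (X k i \<omega> - X l j \<omega>) - theta k l))"
proof -
  have "drift N k = (\<Sum>l\<in>UNIV - {k}. (real (N l) / real (total_size N)) *\<^sub>R theta k l)"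
    unfolding drift_def by (subst sum.remove[of UNIV k]) auto
  also have "\<dots> = (\<Sum>l\<in>UNIV - {k}. (1 / (real (total_size N) * real (N k))) *\<^sub>R
       (\<Sum>i<N k. \<Sum>j<N l. theta k l))"
    using N by (intro sum.cong refl) (simp add: sum_constant_scaleR field_simps)
  finally show ?thesis
    by (simp add: mean_rank_eq sum_subtractf scaleR_diff_right)
qed

lemma integrable_mean_rank: "integrable M (\<lambda>\<omega>. mean_rank N (\<lambda>k i. X k i \<omega>) k)"
  by (rule integrable_bounded[where b = 1]) (simp_all add: borel_measurable_mean_rank norm_mean_rank_le)

lemma expectation_mean_rank:
  assumes N: "N k > 0"
  shows "(\<integral>\<omega>. mean_rank N (\<lambda>k i. X k i \<omega>) k \<partial>M) = drift N k"
proof -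
  have "(\<integral>\<omega>. mean_rank N (\<lambda>k i. X k i \<omega>) k - drift N k \<partial>M) = 0"
    unfolding mean_rank_minus_drift[where N = N, OF N]
    by (simp add: Bochner_Integration.integral_sum Bochner_Integration.integrable_sum
        integrable_sgn_diff expectation_sgn_diff prob_space)
  then show ?thesis by (simp add: integrable_mean_rank prob_space)
qed

text \<open>A sign and its mean each have norm at most 1, so the centred summands are bounded by 2;
  squared, this is the constant 4.\<close>

lemma second_moment_mean_rank:
  assumes N: "N k > 0"
  shows "(\<integral>\<omega>. (norm (sqrt (real (N k)) *\<^sub>R (mean_rank N (\<lambda>k i. X k i \<omega>) k - drift N k)))\<^sup>2 \<partial>M)
     \<le> 4 * real CARD('k)"
proof -
  have "norm (theta k l) \<le> 1" for l
    unfolding theta_def using integral_norm_bound[THEN order_trans, of M "\<lambda>\<omega>. sgn (X k 0 \<omega> - X l 0 \<omega>)" 1]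
      integral_mono[of M "\<lambda>\<omega>. norm (sgn (X k 0 \<omega> - X l 0 \<omega>))" "\<lambda>_. 1"]
    by (simp add: integrable_sgn_diff norm_sgn_le_1 prob_space)
  then have "norm (sgn (X k i \<omega> - X l j \<omega>) - theta k l) \<le> 2" for l i j \<omega>
    using norm_triangle_ineq4[of "sgn (X k i \<omega> - X l j \<omega>)" "theta k l"]
      norm_sgn_le_1[of "X k i \<omega> - X l j \<omega>"] by (smt (verit))
  then have "(\<integral>\<omega>. (norm (sqrt (real (N k)) *\<^sub>R (mean_rank N (\<lambda>k i. X k i \<omega>) k - drift N k)))\<^sup>2 \<partial>M)
     \<le> 2\<^sup>2 * real CARD('k)"
    unfolding mean_rank_minus_drift[where N = N, OF N]
    by (intro second_moment_group[OF prob_space_axioms] sgn_diff_uncorrelated) auto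
  then show ?thesis by simp
qed

lemma norm_expectation_rank_vector_ge:
  assumes N: "N k > 0"
  shows "sqrt (real (N k)) * norm (drift N k) \<le> norm (\<integral>\<omega>. rank_vector N (\<lambda>k i. X k i \<omega>) \<partial>M)"
proof -
  have comp: "rank_vector N x $ k = sqrt (real (N k)) *\<^sub>R mean_rank N x k" for k and x :: "'k \<Rightarrow> nat \<Rightarrow> 'a"
    by (simp add: rank_vector_def)
  have int: "integrable M (\<lambda>\<omega>. rank_vector N (\<lambda>k i. X k i \<omega>))"
  proof (rule integrable_bounded)
    show "(\<lambda>\<omega>. rank_vector N (\<lambda>k i. X k i \<omega>)) \<in> borel_measurable M"
      by (rule borel_measurable_vec)
         (simp add: comp borel_measurable_scaleR borel_measurable_mean_rank[of X M, OF X_measurable])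
    fix \<omega>
    have "norm (rank_vector N (\<lambda>k i. X k i \<omega>)) \<le> (\<Sum>k\<in>UNIV. norm (rank_vector N (\<lambda>k i. X k i \<omega>) $ k))"
      unfolding norm_vec_def by (rule L2_set_le_sum) simp
    also have "\<dots> \<le> (\<Sum>k\<in>UNIV. sqrt (real (N k)) * 1)"
      unfolding comp norm_scaleR by (intro sum_mono mult_mono norm_mean_rank_le) auto
    finally show "norm (rank_vector N (\<lambda>k i. X k i \<omega>)) \<le> (\<Sum>k\<in>UNIV. sqrt (real (N k)) * 1)" .
  qed
  have "(\<integral>\<omega>. rank_vector N (\<lambda>k i. X k i \<omega>) \<partial>M) $ k = (\<integral>\<omega>. rank_vector N (\<lambda>k i. X k i \<omega>) $ k \<partial>M)"
    by (rule integral_bounded_linear[OF bounded_linear_vec_nth int, symmetric])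
  also have "\<dots> = sqrt (real (N k)) *\<^sub>R drift N k"
    unfolding comp by (simp add: expectation_mean_rank[where N = N, OF N])
  finally show ?thesis
    using Finite_Cartesian_Product.norm_nth_le[of "\<integral>\<omega>. rank_vector N (\<lambda>k i. X k i \<omega>) \<partial>M" k] by simp
qed

text \<open>Chebyshev's inequality: if the statistic is at most \<open>c\<close>, so is the squared
  norm of component \<open>k\<close>. As the mean of that component has norm above
  \<open>sqrt c\<close>, the deviation from the mean is at least the difference of the two, called
  \<open>r\<close> below.\<close>

lemma prob_SS_le:
  assumes N: "N k > 0" and large: "sqrt (real (N k)) * norm (drift N k) > sqrt c" and c: "c \<ge> 0"
  shows "prob {\<omega> \<in> space M. SS N (\<lambda>k i. X k i \<omega>) \<le> c}
     \<le> 4 * real CARD('k) / (sqrt (real (N k)) * norm (drift N k) - sqrt c)\<^sup>2"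
proof -
  define r where "r = sqrt (real (N k)) * norm (drift N k) - sqrt c"
  have r: "r > 0" using large by (simp add: r_def)
  define Z where "Z \<omega> = sqrt (real (N k)) *\<^sub>R (mean_rank N (\<lambda>k i. X k i \<omega>) k - drift N k)" for \<omega>
  have Zm [measurable]: "Z \<in> borel_measurable M"
    unfolding Z_def using borel_measurable_mean_rank[of X M, OF X_measurable] by simp
  have "norm (Z \<omega>) \<le> sqrt (real (N k)) * (1 + norm (drift N k))" for \<omega>
    unfolding Z_def norm_scaleR
    by (intro mult_mono norm_triangle_ineq4[THEN order_trans] add_mono norm_mean_rank_le) auto
  then have Zi: "integrable M (\<lambda>\<omega>. (norm (Z \<omega>))\<^sup>2)"
    by (intro integrable_bounded[where b = "(sqrt (real (N k)) * (1 + norm (drift N k)))\<^sup>2"])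
       (auto intro!: power_mono)
  have "prob {\<omega> \<in> space M. SS N (\<lambda>k i. X k i \<omega>) \<le> c} \<le> prob {\<omega> \<in> space M. r\<^sup>2 \<le> (norm (Z \<omega>))\<^sup>2}"
  proof (rule finite_measure_mono)
    show "{\<omega> \<in> space M. SS N (\<lambda>k i. X k i \<omega>) \<le> c} \<subseteq> {\<omega> \<in> space M. r\<^sup>2 \<le> (norm (Z \<omega>))\<^sup>2}"
    proof safe
      fix \<omega> assume le: "SS N (\<lambda>k i. X k i \<omega>) \<le> c"
      let ?Y = "sqrt (real (N k)) *\<^sub>R mean_rank N (\<lambda>k i. X k i \<omega>) k"
      have "(norm ?Y)\<^sup>2 \<le> SS N (\<lambda>k i. X k i \<omega>)"
        unfolding SS_eq by (rule member_le_sum) auto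
      then have "norm ?Y \<le> sqrt c" using le by (intro real_le_rsqrt) linarith
      moreover have "norm (sqrt (real (N k)) *\<^sub>R drift N k) \<le> norm ?Y + norm (Z \<omega>)"
        using norm_triangle_ineq4[of ?Y "Z \<omega>"] by (simp add: Z_def scaleR_diff_right)
      ultimately have "r \<le> norm (Z \<omega>)" by (simp add: r_def)
      then show "r\<^sup>2 \<le> (norm (Z \<omega>))\<^sup>2" using r by (intro power_mono) auto
    qed
  qed measurable
  also have "\<dots> \<le> (\<integral>\<omega>. (norm (Z \<omega>))\<^sup>2 \<partial>M) / r\<^sup>2"
    using r by (intro integral_Markov_inequality_measure[where A = "{}"] Zi) auto
  also have "\<dots> \<le> 4 * real CARD('k) / r\<^sup>2"
    using second_moment_mean_rank[where N = N, OF N] by (intro divide_right_mono) (auto simp: Z_def)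
  finally show ?thesis by (simp add: r_def)
qed

end

text \<open>Uniformity of the lower bound in \<open>B\<close> reduces the double limit to a limit in
  \<open>n\<close>: the expectation exceeds a given \<open>a < 1\<close> for all \<open>B\<close> at
  once as soon as \<open>S n\<close> is large with high probability.\<close>

lemma (in prob_space) tendsto_expectation_rejection:
  fixes S :: "nat \<Rightarrow> 'a \<Rightarrow> real" and R :: "nat \<Rightarrow> nat \<Rightarrow> 'a \<Rightarrow> real"
  assumes S [measurable]: "\<And>n. S n \<in> borel_measurable M"
    and S_large: "\<And>c. (\<lambda>n. prob {\<omega> \<in> space M. S n \<omega> > c}) \<longlonglongrightarrow> 1"
    and R: "\<forall>\<^sub>F n in sequentially. \<forall>B. R n B \<in> borel_measurable M"
    and bounds: "\<And>n B \<omega>. 0 \<le> R n B \<omega>" "\<And>n B \<omega>. R n B \<omega> \<le> 1"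
    and lower: "\<forall>\<^sub>F n in sequentially. \<forall>B \<omega>. S n \<omega> > 0 \<longrightarrow> 1 - C / S n \<omega> \<le> R n B \<omega>"
  shows "((\<lambda>(n, B). expectation (R n B)) \<longlongrightarrow> 1) (sequentially \<times>\<^sub>F sequentially)"
proof (rule order_tendstoI)
  have integrable: "integrable M (R n B)" if "R n B \<in> borel_measurable M" for n B
    using bounds by (intro integrable_bounded[OF that, where b = 1]) auto
  {
    fix a :: real assume a: "a < 1"
    \<comment> \<open>\<open>1 - \<epsilon>\<close> is the midpoint of \<open>a\<close> and 1, hence
      above \<open>a\<close>; on the event \<open>S n \<omega> > c\<close> the loss
      \<open>C / S n \<omega>\<close> is at most \<open>\<epsilon>\<close>. The maximum with 0 in
      \<open>c\<close> keeps \<open>S n \<omega>\<close> positive there whatever the sign of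
      \<open>C\<close>.\<close>
    define \<epsilon> where "\<epsilon> = (1 - a) / 2"
    define c where "c = max 0 (C / \<epsilon>)"
    have \<epsilon>: "\<epsilon> > 0" using a by (simp add: \<epsilon>_def)
    have "(\<lambda>n. (1 - \<epsilon>) * prob {\<omega> \<in> space M. S n \<omega> > c}) \<longlonglongrightarrow> (1 - \<epsilon>) * 1"
      by (intro tendsto_intros S_large)
    moreover have "a < (1 - \<epsilon>) * 1" using a by (simp add: \<epsilon>_def field_simps)
    ultimately have "\<forall>\<^sub>F n in sequentially. a < (1 - \<epsilon>) * prob {\<omega> \<in> space M. S n \<omega> > c}"
      by (rule order_tendstoD)
    with R lower have "\<forall>\<^sub>F n in sequentially. \<forall>B. a < expectation (R n B)"
    proof eventually_elim
      case (elim n)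
      show ?case
      proof
        fix B
        have "(1 - \<epsilon>) * indicator {\<omega> \<in> space M. S n \<omega> > c} \<omega> \<le> R n B \<omega>" for \<omega>
        proof (cases "S n \<omega> > c")
          case True
          then have pos: "S n \<omega> > 0" and "C / \<epsilon> < S n \<omega>" by (auto simp: c_def)
          then have "C / S n \<omega> \<le> \<epsilon>" using \<epsilon> by (simp add: field_simps)
          moreover have "1 - C / S n \<omega> \<le> R n B \<omega>" using elim(2) pos by blast
          ultimately show ?thesis using bounds(1)[of n B \<omega>] by (simp add: indicator_def)
        qed (simp add: bounds)
        moreover have "integrable M (R n B)" using elim(1) by (simp add: integrable)
        moreover have "integrable M (\<lambda>\<omega>. (1 - \<epsilon>) * indicator {\<omega> \<in> space M. S n \<omega> > c} \<omega>)"
          by (intro integrable_mult_right integrable_real_indicator) (simp_all add: emeasure_eq_measure)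
        ultimately have "expectation (\<lambda>\<omega>. (1 - \<epsilon>) * indicator {\<omega> \<in> space M. S n \<omega> > c} \<omega>)
            \<le> expectation (R n B)"
          by (intro integral_mono)
        then show "a < expectation (R n B)" using elim(3) by simp
      qed
    qed
    then have "\<forall>\<^sub>F p in sequentially \<times>\<^sub>F sequentially. \<forall>B. a < expectation (R (fst p) B)"
      by (rule eventually_compose_filterlim) (rule filterlim_fst)
    then show "\<forall>\<^sub>F p in sequentially \<times>\<^sub>F sequentially. a < (case p of (n, B) \<Rightarrow> expectation (R n B))"
      by eventually_elim (simp add: split_beta)
  }
  fix a :: real assume a: "1 < a"
  from R have "\<forall>\<^sub>F n in sequentially. \<forall>B. expectation (R n B) < a"
  proof eventually_elim
    case (elim n)
    show ?case
    proof
      fix B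
      have "expectation (R n B) \<le> expectation (\<lambda>_. 1)"
        using elim by (intro integral_mono) (simp_all add: integrable bounds)
      then show "expectation (R n B) < a" using a by (simp add: prob_space)
    qed
  qed
  then have "\<forall>\<^sub>F p in sequentially \<times>\<^sub>F sequentially. \<forall>B. expectation (R (fst p) B) < a"
    by (rule eventually_compose_filterlim) (rule filterlim_fst)
  then show "\<forall>\<^sub>F p in sequentially \<times>\<^sub>F sequentially. (case p of (n, B) \<Rightarrow> expectation (R n B)) < a"
    by eventually_elim (simp add: split_beta)
qed

theorem theorem2p5:
  fixes M :: "'w measure"
    and P :: "'k::finite \<Rightarrow> ('a::{real_inner, banach, second_countable_topology}) measure"
    and X :: "'k \<Rightarrow> nat \<Rightarrow> 'w \<Rightarrow> 'a"
    and N :: "nat \<Rightarrow> 'k \<Rightarrow> nat"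
    and lam :: "'k \<Rightarrow> real"
  assumes K: "CARD('k) \<ge> 2"
    and P: "\<And>k. prob_space (P k)" "\<And>k. sets (P k) = sets borel"
    and nonatomic: "\<And>k y. measure (P k) {y} = 0"
    and M: "prob_space M"
    and indep: "prob_space.indep_vars M (\<lambda>_. borel) (\<lambda>(k, i). X k i) UNIV"
    and law: "\<And>k i. distr M borel (X k i) = P k"
    and size: "\<And>n. (\<Sum>k\<in>UNIV. N n k) = n"
    and lam: "\<And>k. 0 < lam k" "\<And>k. lam k < 1"
    and ratio: "\<And>k. (\<lambda>n. real (N n k) / real n) \<longlonglongrightarrow> lam k"
    and not_null: "\<not> (\<forall>k l. P k = P l)"
    and alternative: "\<exists>k. (\<Sum>l\<in>UNIV. lam l *\<^sub>R (\<integral>\<omega>. sgn (X k 0 \<omega> - X l 0 \<omega>) \<partial>M)) \<noteq> 0"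
  shows "filterlim (\<lambda>n. norm (\<integral>\<omega>. rank_vector (N n) (\<lambda>k i. X k i \<omega>) \<partial>M)) at_top sequentially
    \<and> (\<forall>c::real. (\<lambda>n. measure M {\<omega> \<in> space M. SS (N n) (\<lambda>k i. X k i \<omega>) > c}) \<longlonglongrightarrow> 1)
    \<and> (\<forall>\<alpha>::real. 0 < \<alpha> \<and> \<alpha> < 1 \<longrightarrow>
         (\<lambda>n. measure M {\<omega> \<in> space M. asymptotic_pvalue (N n) (\<lambda>k i. X k i \<omega>) \<le> \<alpha>})
            \<longlonglongrightarrow> 1
       \<and> ((\<lambda>(n, B). \<integral>\<omega>. resampling_rejection_prob (bootstrap_pmf (N n)) \<alpha> (N n) B
                            (\<lambda>k i. X k i \<omega>) \<partial>M)
            \<longlongrightarrow> 1) (sequentially \<times>\<^sub>F sequentially)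
       \<and> ((\<lambda>(n, B). \<integral>\<omega>. resampling_rejection_prob (permutation_pmf (N n)) \<alpha> (N n) B
                            (\<lambda>k i. X k i \<omega>) \<partial>M)
            \<longlongrightarrow> 1) (sequentially \<times>\<^sub>F sequentially))"
proof -
  interpret prob_space M by fact
  interpret k_sample M P X
    by unfold_locales (fact indep law)+
  have total [simp]: "total_size (N n) = n" for n
    by (simp add: total_size_def size)
  have N_top: "filterlim (\<lambda>n. real (N n k)) at_top sequentially" for k
  proof -
    have "filterlim (\<lambda>n. real (N n k) / real n * real n) at_top sequentially"
      by (rule filterlim_tendsto_pos_mult_at_top[OF ratio lam(1) filterlim_real_sequentially])
    moreover have "\<forall>\<^sub>F n in sequentially. real (N n k) / real n * real n = real (N n k)"
      using eventually_gt_at_top[of 0] by eventually_elim simp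
    ultimately show ?thesis by (simp add: filterlim_cong[OF refl refl])
  qed
  have N_ge_2: "\<forall>\<^sub>F n in sequentially. \<forall>k. N n k \<ge> 2"
  proof (rule eventually_all_finite)
    show "\<forall>\<^sub>F n in sequentially. N n k \<ge> 2" for k
      using N_top[of k] unfolding filterlim_at_top by (auto dest: spec[of _ 2])
  qed
  obtain k where k: "(\<Sum>l\<in>UNIV. lam l *\<^sub>R theta k l) \<noteq> 0"
    using alternative by (auto simp: theta_def)
  \<comment> \<open>This is both a lower bound for the norm of the mean and the distance that random
    deviations have to overcome. It diverges because the drift tends to a nonzero vector while the
    group size grows.\<close>
  define m where "m n = sqrt (real (N n k)) * norm (drift (N n) k)" for n
  have "(\<lambda>n. norm (drift (N n) k)) \<longlonglongrightarrow> norm (\<Sum>l\<in>UNIV. lam l *\<^sub>R theta k l)"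
    unfolding drift_def total by (intro tendsto_intros ratio)
  moreover have "filterlim (\<lambda>n. sqrt (real (N n k))) at_top sequentially"
    by (rule filterlim_compose[OF sqrt_at_top N_top])
  ultimately have m_top: "filterlim m at_top sequentially"
    unfolding m_def mult.commute[of "sqrt _"] using k
    by (intro filterlim_tendsto_pos_mult_at_top[where c = "norm (\<Sum>l\<in>UNIV. lam l *\<^sub>R theta k l)"]) auto
  have mean_top: "filterlim (\<lambda>n. norm (\<integral>\<omega>. rank_vector (N n) (\<lambda>k i. X k i \<omega>) \<partial>M)) at_top sequentially"
    using m_top
  proof (rule filterlim_at_top_mono)
    show "\<forall>\<^sub>F n in sequentially. m n \<le> norm (\<integral>\<omega>. rank_vector (N n) (\<lambda>k i. X k i \<omega>) \<partial>M)"
      using N_ge_2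
    proof eventually_elim
      case (elim n)
      then have "N n k > 0" by (metis less_le_trans zero_less_numeral)
      then show ?case unfolding m_def by (rule norm_expectation_rank_vector_ge)
    qed
  qed
  note SS_measurable = borel_measurable_SS[of X M, OF X_measurable]
  note [measurable] = SS_measurable
  have SS_large: "(\<lambda>n. prob {\<omega> \<in> space M. SS (N n) (\<lambda>k i. X k i \<omega>) > c}) \<longlonglongrightarrow> 1" for c
  proof (rule tendsto_sandwich[OF _ _ _ tendsto_const])
    \<comment> \<open>\<open>prob_SS_le\<close> asks for a nonnegative threshold; raising
      \<open>c\<close> to 0 only shrinks the event that is bounded from below.\<close>
    let ?c = "max c 0"
    have "filterlim (\<lambda>n. (m n - sqrt ?c)\<^sup>2) at_top sequentially"
      unfolding diff_conv_add_uminus add.commute[of _ "- sqrt _"]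
      by (intro filterlim_pow_at_top filterlim_tendsto_add_at_top[OF tendsto_const m_top]) auto
    then have "(\<lambda>n. 4 * real CARD('k) / (m n - sqrt ?c)\<^sup>2) \<longlonglongrightarrow> 0"
      by (intro tendsto_divide_0[OF tendsto_const] filterlim_at_top_imp_at_infinity)
    then show "(\<lambda>n. 1 - 4 * real CARD('k) / (m n - sqrt ?c)\<^sup>2) \<longlonglongrightarrow> 1"
      using tendsto_diff[OF tendsto_const[of 1]] by force
    have "\<forall>\<^sub>F n in sequentially. m n > sqrt ?c"
      using m_top unfolding filterlim_at_top_dense by blast
    with N_ge_2 show "\<forall>\<^sub>F n in sequentially. 1 - 4 * real CARD('k) / (m n - sqrt ?c)\<^sup>2
        \<le> prob {\<omega> \<in> space M. SS (N n) (\<lambda>k i. X k i \<omega>) > c}"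
    proof eventually_elim
      case (elim n)
      then have "N n k > 0" by (metis less_le_trans zero_less_numeral)
      then have "prob {\<omega> \<in> space M. SS (N n) (\<lambda>k i. X k i \<omega>) \<le> ?c}
          \<le> 4 * real CARD('k) / (m n - sqrt ?c)\<^sup>2"
        unfolding m_def using elim(2) by (intro prob_SS_le) (auto simp: m_def)
      moreover have "prob {\<omega> \<in> space M. \<not> SS (N n) (\<lambda>k i. X k i \<omega>) \<le> ?c}
          = 1 - prob {\<omega> \<in> space M. SS (N n) (\<lambda>k i. X k i \<omega>) \<le> ?c}"
        by (rule prob_neg) measurable
      moreover have "prob {\<omega> \<in> space M. \<not> SS (N n) (\<lambda>k i. X k i \<omega>) \<le> ?c}
          \<le> prob {\<omega> \<in> space M. SS (N n) (\<lambda>k i. X k i \<omega>) > c}"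
        by (rule finite_measure_mono) auto
      ultimately show ?case by linarith
    qed
  qed simp_all
  have asymptotic: "(\<lambda>n. prob {\<omega> \<in> space M. asymptotic_pvalue (N n) (\<lambda>k i. X k i \<omega>) \<le> \<alpha>}) \<longlonglongrightarrow> 1"
    if \<alpha>: "\<alpha> > 0" for \<alpha>
  proof (rule tendsto_sandwich[OF _ _ SS_large tendsto_const])
    \<comment> \<open>The value of the statistic at which the bound of
      \<open>asymptotic_pvalue_le\<close> equals \<open>\<alpha>\<close>; beyond it the test
      rejects.\<close>
    let ?c = "48 * (real CARD('k))\<^sup>2 / \<alpha>"
    show "\<forall>\<^sub>F n in sequentially. prob {\<omega> \<in> space M. SS (N n) (\<lambda>k i. X k i \<omega>) > ?c}
        \<le> prob {\<omega> \<in> space M. asymptotic_pvalue (N n) (\<lambda>k i. X k i \<omega>) \<le> \<alpha>}"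
      using N_ge_2
    proof eventually_elim
      case (elim n)
      note [measurable] = borel_measurable_asymptotic_pvalue[of "N n" X M, OF elim[rule_format] X_measurable]
      show ?case
      proof (rule finite_measure_mono)
        show "{\<omega> \<in> space M. SS (N n) (\<lambda>k i. X k i \<omega>) > ?c}
            \<subseteq> {\<omega> \<in> space M. asymptotic_pvalue (N n) (\<lambda>k i. X k i \<omega>) \<le> \<alpha>}"
        proof safe
          fix \<omega> assume large: "SS (N n) (\<lambda>k i. X k i \<omega>) > ?c"
          have "?c \<ge> 0" using \<alpha> by simp
          then have pos: "SS (N n) (\<lambda>k i. X k i \<omega>) > 0" using large by linarith
          have "asymptotic_pvalue (N n) (\<lambda>k i. X k i \<omega>)
              \<le> 48 * (real CARD('k))\<^sup>2 / SS (N n) (\<lambda>k i. X k i \<omega>)"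
            using elim pos by (intro asymptotic_pvalue_le) auto
          also have "\<dots> \<le> \<alpha>" using large pos \<alpha> by (simp add: field_simps)
          finally show "asymptotic_pvalue (N n) (\<lambda>k i. X k i \<omega>) \<le> \<alpha>" .
        qed
      qed measurable
    qed
  qed simp
  \<comment> \<open>One argument for both resampling laws, which enter through finiteness of the
    support and the moment bound. The restriction to \<open>n > 0\<close> is for the bootstrap,
    whose pool must not be empty.\<close>
  have resampling: "((\<lambda>(n, B). \<integral>\<omega>. resampling_rejection_prob (D n) \<alpha> (N n) B (\<lambda>k i. X k i \<omega>) \<partial>M)
      \<longlongrightarrow> 1) (sequentially \<times>\<^sub>F sequentially)"
    if \<alpha>: "\<alpha> > 0" and fin: "\<And>n. n > 0 \<Longrightarrow> finite (set_pmf (D n))"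
      and moment: "\<And>n (x :: 'k \<Rightarrow> nat \<Rightarrow> 'a). n > 0 \<Longrightarrow>
        (\<integral>f. SS (N n) (resample x f) \<partial>measure_pmf (D n)) \<le> (real CARD('k))\<^sup>2"
    for \<alpha> and D :: "nat \<Rightarrow> ('k \<times> nat \<Rightarrow> 'k \<times> nat) pmf"
  proof (rule tendsto_expectation_rejection[OF SS_measurable SS_large])
    show "\<forall>\<^sub>F n in sequentially. \<forall>B. (\<lambda>\<omega>. resampling_rejection_prob (D n) \<alpha> (N n) B (\<lambda>k i. X k i \<omega>))
        \<in> borel_measurable M"
      using eventually_gt_at_top[of 0]
      by eventually_elim (intro allI borel_measurable_resampling_rejection_prob fin X_measurable)
    show "\<forall>\<^sub>F n in sequentially. \<forall>B \<omega>. SS (N n) (\<lambda>k i. X k i \<omega>) > 0 \<longrightarrow>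
        1 - (real CARD('k))\<^sup>2 / \<alpha> / SS (N n) (\<lambda>k i. X k i \<omega>)
          \<le> resampling_rejection_prob (D n) \<alpha> (N n) B (\<lambda>k i. X k i \<omega>)"
      using eventually_gt_at_top[of 0]
    proof eventually_elim
      case (elim n)
      show ?case
      proof (intro allI impI)
        fix B \<omega> assume pos: "SS (N n) (\<lambda>k i. X k i \<omega>) > 0"
        from resampling_rejection_prob_ge[OF fin[OF elim] \<alpha> pos moment[OF elim], of B]
        show "1 - (real CARD('k))\<^sup>2 / \<alpha> / SS (N n) (\<lambda>k i. X k i \<omega>)
            \<le> resampling_rejection_prob (D n) \<alpha> (N n) B (\<lambda>k i. X k i \<omega>)" by simp
      qed
    qed
  qed (simp_all add: resampling_rejection_prob_bounds)
  show ?thesis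
  proof (intro conjI allI impI)
    fix \<alpha> :: real assume "0 < \<alpha> \<and> \<alpha> < 1"
    then have \<alpha>: "\<alpha> > 0" by simp
    show "(\<lambda>n. prob {\<omega> \<in> space M. asymptotic_pvalue (N n) (\<lambda>k i. X k i \<omega>) \<le> \<alpha>}) \<longlonglongrightarrow> 1"
      by (rule asymptotic[OF \<alpha>])
    show "((\<lambda>(n, B). \<integral>\<omega>. resampling_rejection_prob (bootstrap_pmf (N n)) \<alpha> (N n) B
        (\<lambda>k i. X k i \<omega>) \<partial>M) \<longlongrightarrow> 1) (sequentially \<times>\<^sub>F sequentially)"
      by (rule resampling[OF \<alpha>]) (simp_all add: finite_set_bootstrap_pmf bootstrap_second_moment)
    show "((\<lambda>(n, B). \<integral>\<omega>. resampling_rejection_prob (permutation_pmf (N n)) \<alpha> (N n) B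
        (\<lambda>k i. X k i \<omega>) \<partial>M) \<longlongrightarrow> 1) (sequentially \<times>\<^sub>F sequentially)"
      by (rule resampling[OF \<alpha>]) (simp_all add: finite_set_permutation_pmf permutation_second_moment)
  qed (fact mean_top SS_large)+
qed

end
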